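(* Let $(K,|\cdot|)$ be a non-Archimedean nontrivially valued field, let $n\ge 2$, and let $\|\cdot\|$ be a non-Archimedean norm on $K^n$ equivalent to the maximum norm $\|\cdot\|_\infty$. Let $G$ be the group of all affine isometries of $(K^n,\|\cdot\|)$. Then each of the following subsets of $K^n$ is $G$-paradoxical using four pieces: the whole space $K^n$; any closed ball $B[x_0,r]$; any open ball $B(x_0,r)$; and any nonempty sphere $S[x_0,r]$, where $x_0\in K^n$ and $r>0$ are arbitrary.
   Context: A non-Archimedean valuation on a field $K$ is a function $|\cdot|\colon K\to[0,\infty)$ with $|x|=0\Leftrightarrow x=0$, $|xy|=|x||y|$, $|x+y|\le\max\{|x|,|y|\}$; it is trivial if $|x|=1$ for all $x\ne0$, and nontrivial otherwise. The pair $(K,|\cdot|)$ is then called a non-Archimedean valued field. A non-Archimedean norm on a $K$-linear space $X$ is a function $\|\cdot\|\colon X\to[0,\infty)$ with $\|x\|=0\Leftrightarrow x=0$, $\|\alpha x\|=|\alpha|\|x\|$, $\|x+y\|\le\max\{\|x\|,\|y\|\}$. Two norms $\|\cdot\|_1,\|\cdot\|_2$ on $X$ are equivalent if there are $C_1,C_2>0$ with $C_1\|x\|_1\le\|x\|_2\le C_2\|x\|_1$ for all $x\in X$. The maximum norm on $K^n$ is $\|x\|_\infty=\max_{1\le i\le n}|x_i|$. Balls and spheres are taken with respect to $\|\cdot\|$: $B[x_0,r]=\{x:\|x-x_0\|\le r\}$, $B(x_0,r)=\{x:\|x-x_0\|<r\}$, $S[x_0,r]=\{x:\|x-x_0\|=r\}$.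 An affine isometry of $(K^n,\|\cdot\|)$ is a map $x\mapsto Lx+\tau$ with $L\in\mathrm{GL}(n,K)$ satisfying $\|Lx\|=\|x\|$ for all $x\in K^n$, and $\tau\in K^n$. Let $G$ be a group acting on a set $X$. A nonempty subset $E\subseteq X$ (not necessarily $G$-invariant) is $G$-paradoxical using $r$ pieces if for some positive integers $m,l$ with $m+l=r$ there exist pairwise disjoint subsets $A_1,\dots,A_m,B_1,\dots,B_l$ of $E$ and elements $g_1,\dots,g_m,h_1,\dots,h_l\in G$ such that $E=A_1\sqcup\dots\sqcup A_m\sqcup B_1\sqcup\dots\sqcup B_l=\bigsqcup_{i=1}^m g_i(A_i)=\bigsqcup_{j=1}^l h_j(B_j)$, where $\sqcup$ and $\bigsqcup$ denote unions of pairwise disjoint sets. *)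

theory Defs
  imports "HOL-Library.Disjoint_Sets" "HOL-Analysis.Cartesian_Space" "HOL-Algebra.Group_Action"
begin

definition na_valuation :: "('k::field \<Rightarrow> real) \<Rightarrow> bool" where
  "na_valuation v \<longleftrightarrow>
     (\<forall>x. v x \<ge> 0) \<and>
     (\<forall>x. v x = 0 \<longleftrightarrow> x = 0) \<and>
     (\<forall>x y. v (x * y) = v x * v y) \<and>
     (\<forall>x y. v (x + y) \<le> max (v x) (v y))"

definition trivial_valuation :: "('k::field \<Rightarrow> real) \<Rightarrow> bool" where
  "trivial_valuation v \<longleftrightarrow> (\<forall>x. x \<noteq> 0 \<longrightarrow> v x = 1)"

definition na_norm :: "('k::field \<Rightarrow> real) \<Rightarrow> ('k ^ 'n \<Rightarrow> real) \<Rightarrow> bool" where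
  "na_norm v N \<longleftrightarrow>
     (\<forall>x. N x \<ge> 0) \<and>
     (\<forall>x. N x = 0 \<longleftrightarrow> x = 0) \<and>
     (\<forall>a x. N (a *s x) = v a * N x) \<and>
     (\<forall>x y. N (x + y) \<le> max (N x) (N y))"

definition equivalent_norms :: "('x \<Rightarrow> real) \<Rightarrow> ('x \<Rightarrow> real) \<Rightarrow> bool" where
  "equivalent_norms N1 N2 \<longleftrightarrow>
     (\<exists>C1>0. \<exists>C2>0. \<forall>x. C1 * N1 x \<le> N2 x \<and> N2 x \<le> C2 * N1 x)"

definition max_norm :: "('k::field \<Rightarrow> real) \<Rightarrow> 'k ^ 'n \<Rightarrow> real" where
  "max_norm v x = Max (range (\<lambda>i. v (x $ i)))"

definition norm_cball :: "('k::field ^ 'n \<Rightarrow> real) \<Rightarrow> 'k ^ 'n \<Rightarrow> real \<Rightarrow> ('k ^ 'n) set" where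
  "norm_cball N x0 r = {x. N (x - x0) \<le> r}"

definition norm_ball :: "('k::field ^ 'n \<Rightarrow> real) \<Rightarrow> 'k ^ 'n \<Rightarrow> real \<Rightarrow> ('k ^ 'n) set" where
  "norm_ball N x0 r = {x. N (x - x0) < r}"

definition norm_sphere :: "('k::field ^ 'n \<Rightarrow> real) \<Rightarrow> 'k ^ 'n \<Rightarrow> real \<Rightarrow> ('k ^ 'n) set" where
  "norm_sphere N x0 r = {x. N (x - x0) = r}"

definition affine_isometry :: "('k::field ^ 'n \<Rightarrow> real) \<Rightarrow> ('k ^ 'n \<Rightarrow> 'k ^ 'n) \<Rightarrow> bool" where
  "affine_isometry N f \<longleftrightarrow>
     (\<exists>(L :: 'k ^ 'n ^ 'n) t.
        invertible L \<and> (\<forall>x. N (L *v x) = N x) \<and> f = (\<lambda>x. L *v x + t))"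

definition affine_isometry_group ::
    "('k::field ^ 'n \<Rightarrow> real) \<Rightarrow> ('k ^ 'n \<Rightarrow> 'k ^ 'n) monoid" where
  "affine_isometry_group N = \<lparr>carrier = Collect (affine_isometry N), mult = (\<circ>), one = id\<rparr>"

text \<open>The standing assumption that \<open>G\<close> is a group acting on \<open>X\<close> (via \<open>\<phi>\<close>) is part of the
  predicate. The set \<open>E\<close> need not be invariant, and pieces are allowed to be empty.\<close>

definition paradoxical_using ::
    "('g, 'm) monoid_scheme \<Rightarrow> 'x set \<Rightarrow> ('g \<Rightarrow> 'x \<Rightarrow> 'x) \<Rightarrow> 'x set \<Rightarrow> nat \<Rightarrow> bool" where
  "paradoxical_using G X \<phi> E r \<longleftrightarrow>
     group_action G X \<phi> \<and> E \<subseteq> X \<and> E \<noteq> {} \<and>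
     (\<exists>(m::nat) (l::nat) (A :: nat \<Rightarrow> 'x set) (B :: nat \<Rightarrow> 'x set) (g :: nat \<Rightarrow> 'g) (h :: nat \<Rightarrow> 'g).
        m > 0 \<and> l > 0 \<and> m + l = r \<and>
        (\<forall>i<m. g i \<in> carrier G) \<and> (\<forall>j<l. h j \<in> carrier G) \<and>
        disjoint_family_on A {..<m} \<and> disjoint_family_on B {..<l} \<and>
        (\<Union>i<m. A i) \<inter> (\<Union>j<l. B j) = {} \<and>
        E = (\<Union>i<m. A i) \<union> (\<Union>j<l. B j) \<and>
        disjoint_family_on (\<lambda>i. \<phi> (g i) ` A i) {..<m} \<and> E = (\<Union>i<m. \<phi> (g i) ` A i) \<and>
        disjoint_family_on (\<lambda>j. \<phi> (h j) ` B j) {..<l} \<and> E = (\<Union>j<l. \<phi> (h j) ` B j))"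

end

theory Submission
  imports Defs "HOL-Computational_Algebra.Polynomial"
begin

text \<open>
  A set is paradoxical with four pieces as soon as two bijections \<open>\<sigma>\<close> and \<open>\<tau>\<close> of it admit a
  labelling of its points by the four letters \<open>\<sigma>\<close>, \<open>\<sigma>\<inverse>\<close>, \<open>\<tau>\<close>, \<open>\<tau>\<inverse>\<close> such that every edge \<open>{x, s x}\<close> of the
  orbit graph is picked by exactly one of its ends. Equivalently, the edges can be oriented with one
  edge leaving every vertex. This is possible when every component of the graph has at most one
  cycle: orient the cycle cyclically and everything else towards it, or, in a tree, towards an end.

  So one needs \<open>\<sigma>\<close> and \<open>\<tau>\<close> that preserve all the sets in question and generate
  a group with small stabilizers. For the ultrametric norm, every affine map that differs from the
  identity by a small amount is an isometry, and it preserves all balls and spheres of radius greater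
  than the displacement of their centre. The difficulty is to see that such maps near the identity are
  nevertheless free enough. The idea is to look at them through a second absolute value \<open>\<alpha>\<close>: there is an
  element \<open>\<pi>\<close> with \<open>v \<pi> < 1\<close> that is large for an absolute value on a subring containing it, namely the usual
  absolute value on the integers or an exponential of the degree of polynomials in \<open>\<pi>\<close> (lemma
  \<open>two_absolute_values\<close>). Maps of the plane that are diagonal with entries \<open>1 + \<pi> ^ m\<close> and its
  inverse in suitable affine coordinates are close to the identity for \<open>v\<close> and strongly
  hyperbolic for \<open>\<alpha>\<close>.

  Take two such maps whose four invariant lines, together with the line at infinity, are in
  general position. Measure a point by the \<open>\<alpha>\<close>-sizes of the affine forms defining the lines. A letter
  moves a point away to infinity, and all further letters of a reduced word do the same, unless the
  point is near the line contracted by the letter. By general position a point is near at most two of the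
  four lines, so that at most two letters at each vertex can belong to a cycle
  (\<open>labelling_by_ping_pong\<close>, \<open>labelling_if_escaping\<close>). Fixed points, which an affine action on the
  plane cannot avoid, are thereby allowed for. That \<open>\<alpha>\<close> lives only on a subring is repaired by
  extending it to a seminorm of the whole field that is homogeneous over the subring
  (\<open>seminorm_extending_subring_abs\<close>). In dimension greater than two the maps act on two coordinates.
\<close>

section \<open>Labellings by four letters and four-piece decompositions\<close>

text \<open>The generators of a two-generator group and their inverses: \<open>gen\<close> selects the generator and
\<open>inverted\<close> tells whether its inverse is meant.\<close>

datatype letter = Letter (gen: bool) (inverted: bool)

definition linv :: "letter \<Rightarrow> letter" where
  "linv s = Letter (gen s) (\<not> inverted s)"

lemma linv_linv [simp]: "linv (linv s) = s"
  by (simp add: linv_def)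

lemma linv_neq [simp]: "linv s \<noteq> s" "s \<noteq> linv s"
  by (cases s; simp add: linv_def)+

lemma UNIV_letter:
  "(UNIV :: letter set) = {Letter False False, Letter False True, Letter True False, Letter True True}"
proof -
  have "s \<in> {Letter False False, Letter False True, Letter True False, Letter True True}" for s
    by (cases s) auto
  then show ?thesis by blast
qed

instance letter :: finite
  by standard (simp add: UNIV_letter)

text \<open>Think of the graph whose vertices are the points and whose edges join \<open>x\<close> to \<open>act s x\<close>. A labelling
\<open>l\<close> lets every vertex pick one of its four edges, and the hypothesis on \<open>l\<close> says that every edge
is picked by exactly one of its two ends. The points with a given label are then the four pieces:
the two pieces of one generator reassemble to \<open>E\<close> after only one of them has been moved.\<close>

lemma paradoxical_four_if_labelling:
  fixes act :: "letter \<Rightarrow> 'x \<Rightarrow> 'x" and l :: "'x \<Rightarrow> letter"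
  assumes grp: "group_action G UNIV \<phi>" and E: "E \<noteq> {}"
    and act: "\<And>s. \<exists>g \<in> carrier G. \<phi> g = act s"
    and inv: "\<And>s x. act (linv s) (act s x) = x"
    and pres: "\<And>s x. x \<in> E \<Longrightarrow> act s x \<in> E"
    and lab: "\<And>s x. (l x = s) \<noteq> (l (act s x) = linv s)"
  shows "paradoxical_using G UNIV \<phi> E 4"
proof -
  obtain \<gamma> where \<gamma>: "\<And>s. \<gamma> s \<in> carrier G" "\<And>s. \<phi> (\<gamma> s) = act s"
    using act by metis
  have "group G" using group_action.group_hom[OF grp] by (simp add: group_hom_def)
  then have one: "\<phi> \<one>\<^bsub>G\<^esub> = id" "\<one>\<^bsub>G\<^esub> \<in> carrier G"
    using group_action.id_eq_one[OF grp] by (simp_all add: restrict_UNIV id_def group.is_monoid monoid.one_closed)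
  define P where "P s = {x \<in> E. l x = s}" for s
  \<comment> \<open>The labelling condition says that \<open>act s\<close> carries the piece labelled \<open>s\<close> onto the
      complement of the piece labelled \<open>linv s\<close>.\<close>
  have img: "act s ` P s = E - P (linv s)" for s
  proof (intro equalityI subsetI)
    fix y assume "y \<in> act s ` P s"
    then obtain x where x: "x \<in> E" "l x = s" "y = act s x" by (auto simp: P_def)
    then show "y \<in> E - P (linv s)" using pres[OF x(1), of s] lab[of x s] by (simp add: P_def)
  next
    fix y assume y: "y \<in> E - P (linv s)"
    have "act s (act (linv s) y) = y" using inv[of "linv s" y] by simp
    moreover have "l (act (linv s) y) = s" using y lab[of y "linv s"] by (simp add: P_def)
    moreover have "act (linv s) y \<in> E" using y pres by simp
    ultimately show "y \<in> act s ` P s"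
      by (intro image_eqI[of _ _ "act (linv s) y"]) (simp_all add: P_def)
  qed
  have split: "(E - P (linv s)) \<union> P (linv s) = E" for s by (auto simp: P_def)
  define Q where "Q b = (\<lambda>i::nat. P (Letter b (i \<noteq> 0)))" for b
  define k where "k b = (\<lambda>i::nat. if i = 0 then \<gamma> (Letter b False) else \<one>\<^bsub>G\<^esub>)" for b
  have two: "{..<2::nat} = {0, 1}" by auto
  have k: "\<phi> (k b 0) ` Q b 0 = E - P (Letter b True)" "\<phi> (k b 1) ` Q b 1 = P (Letter b True)" for b
    using img[of "Letter b False"] by (simp_all add: k_def Q_def \<gamma> one linv_def)
  have kc: "k b i \<in> carrier G" for b i by (simp add: k_def \<gamma> one)
  have dQ: "disjoint_family_on (Q b) {..<2}" for b
    unfolding two by (auto simp: disjoint_family_on_def Q_def P_def)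
  have dk: "disjoint_family_on (\<lambda>i. \<phi> (k b i) ` Q b i) {..<2}" for b
    unfolding two using k[of b] by (auto simp: disjoint_family_on_def)
  have uk: "E = (\<Union>i<2. \<phi> (k b i) ` Q b i)" for b
    unfolding two using k[of b] split[of "Letter b False"] by (simp add: linv_def)
  have uQ: "(\<Union>i<2. Q b i) = {x \<in> E. gen (l x) = b}" for b
    unfolding two by (auto simp: Q_def P_def) (metis letter.collapse)+
  show ?thesis
    unfolding paradoxical_using_def
    using grp E kc dQ dk uk uQ
    by (intro conjI exI[of _ "2::nat"] exI[of _ "Q False"] exI[of _ "Q True"] exI[of _ "k False"]
        exI[of _ "k True"]) auto
qed

text \<open>Suppose every vertex \<open>x\<close> claims the edge \<open>f x\<close>, and every edge is assigned to the end \<open>x\<close> at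
which \<open>D x s\<close> holds. The set below collects the vertices that keep their claim: those to which no
edge is assigned, and those whose assigned edge is claimed by a vertex already collected.\<close>

inductive keeps_claim :: "(letter \<Rightarrow> 'x \<Rightarrow> 'x) \<Rightarrow> ('x \<Rightarrow> letter) \<Rightarrow> ('x \<Rightarrow> letter \<Rightarrow> bool) \<Rightarrow> 'x \<Rightarrow> bool"
  for act f D where
  start: "(\<And>s. \<not> D x s) \<Longrightarrow> keeps_claim act f D x"
| step: "keeps_claim act f D x \<Longrightarrow> \<not> D x (f x) \<Longrightarrow> keeps_claim act f D (act (f x) x)"

text \<open>This is the Schroeder-Bernstein theorem for vertices and edges, in the form that respects incidence:
from an injective choice \<open>f\<close> of an edge at every vertex and an injective choice \<open>D\<close> of an end for
every edge one obtains a bijection between vertices and edges made from the two choices. It is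
phrased with half-edges \<open>(x, s)\<close> so that loops, which come from fixed points, need no special care.\<close>

lemma labelling_if_two_injections:
  fixes act :: "letter \<Rightarrow> 'x \<Rightarrow> 'x" and f :: "'x \<Rightarrow> letter"
  assumes inv: "\<And>s x. act (linv s) (act s x) = x"
    and f: "\<And>x. f (act (f x) x) \<noteq> linv (f x)"
    and D1: "\<And>x s. D x s \<noteq> D (act s x) (linv s)"
    and D2: "\<And>x s t. D x s \<Longrightarrow> D x t \<Longrightarrow> s = t"
  shows "\<exists>l. \<forall>x s. (l x = s) \<noteq> (l (act s x) = linv s)"
proof -
  let ?R = "keeps_claim act f D"
  define l where "l x = (if ?R x then f x else (THE s. D x s))" for x
  have lR: "?R x \<Longrightarrow> l x = f x" for x by (simp add: l_def)
  have lD: "l x = s" if "\<not> ?R x" "D x s" for x s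
    using that D2 by (auto simp: l_def intro!: the_equality)
  have lD': "D x (l x)" if nR: "\<not> ?R x" for x
  proof -
    obtain s where "D x s" using nR keeps_claim.start[of D x] by blast
    with lD[OF nR this] show ?thesis by simp
  qed
  have key: "(l x = s) \<noteq> (l (act s x) = linv s)" if d: "D x s" for x s
  proof -
    let ?y = "act s x"
    have nd: "\<not> D ?y (linv s)" using D1 d by blast
    have bck: "act (linv s) ?y = x" by (rule inv)
    show ?thesis
    proof (cases "?R x")
      case False
      have "l ?y \<noteq> linv s"
      proof
        assume a: "l ?y = linv s"
        have "?R ?y" using lD'[of ?y] a nd by metis
        then have "?R (act (f ?y) ?y)" using a nd lR by (metis keeps_claim.step)
        then show False using False a lR[OF \<open>?R ?y\<close>] bck by simp
      qed
      then show ?thesis using lD[OF False d] by simp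
    next
      case True
      show ?thesis
      proof (cases "f x = s")
        case fx: True
        have "l ?y \<noteq> linv s"
          using f[of x] lR[of ?y] lD'[of ?y] nd unfolding fx by (cases "?R ?y") auto
        then show ?thesis using lR[OF True] fx by simp
      next
        case False
        from True obtain z where z: "?R z" "\<not> D z (f z)" "x = act (f z) z"
          using d by (cases rule: keeps_claim.cases) auto
        have "D x (linv (f z))" using D1[of z "f z"] z by simp
        then have s: "s = linv (f z)" using D2 d by blast
        have "?y = z" unfolding s z(3) by (rule inv)
        then show ?thesis using z(1) lR[OF True] lR[OF z(1)] False s by simp
      qed
    qed
  qed
  have "(l x = s) \<noteq> (l (act s x) = linv s)" for x s
  proof (cases "D x s")
    case True then show ?thesis by (rule key)
  next
    case False
    then have "D (act s x) (linv s)" using D1 by blast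
    from key[OF this] show ?thesis using inv[of s x] by auto
  qed
  then show ?thesis by blast
qed

text \<open>Read \<open>e\<close> as an oriented edge, \<open>\<iota> e\<close> as its reversal and \<open>T\<close> as the relation of being traversed next.
If the next edge is always unique, then walks form lines and cycles, and one may choose a direction
for each of them, provided that no walk leads from an edge to its own reversal. Such a walk would
have to turn around in its middle, either on an edge (\<open>nofix\<close>) or at a vertex (\<open>noturn\<close>).\<close>

lemma orientation_exists:
  fixes T :: "('e \<times> 'e) set" and \<iota> :: "'e \<Rightarrow> 'e"
  assumes invol: "\<And>e. \<iota> (\<iota> e) = e" and nofix: "\<And>e. \<iota> e \<noteq> e"
    and rev: "\<And>e e'. (e, e') \<in> T \<Longrightarrow> (\<iota> e', \<iota> e) \<in> T"
    and det: "\<And>e e1 e2. (e, e1) \<in> T \<Longrightarrow> (e, e2) \<in> T \<Longrightarrow> e1 = e2"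
    and noturn: "\<And>e. (e, \<iota> e) \<notin> T"
  shows "\<exists>chosen. (\<forall>e. (e \<in> chosen) \<noteq> (\<iota> e \<in> chosen)) \<and> (\<forall>e e'. (e, e') \<in> T \<longrightarrow> (e \<in> chosen \<longleftrightarrow> e' \<in> chosen))"
proof -
  have det': "e1 = e2" if "(e1, e) \<in> T" "(e2, e) \<in> T" for e e1 e2
    using det[OF rev[OF that(1)] rev[OF that(2)]] invol by metis
  have noturns: "(e, \<iota> e) \<notin> T ^^ n" for e n
  proof (induction n arbitrary: e rule: less_induct)
    case (less n)
    show ?case
    proof
      assume a: "(e, \<iota> e) \<in> T ^^ n"
      consider "n = 0" | "n = 1" | k where "n = Suc (Suc k)"
        by (metis One_nat_def not0_implies_Suc)
      then show False
      proof cases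
        case 1 then show ?thesis using a nofix by (metis relpow_0_E)
      next
        case 2 then show ?thesis using a noturn by simp
      next
        case 3
        then obtain e1 e2 where e: "(e, e1) \<in> T" "(e1, e2) \<in> T ^^ k" "(e2, \<iota> e) \<in> T"
          using a by (metis relpow_Suc_D2 relpow_Suc_E)
        have "e2 = \<iota> e1" using det'[OF e(3) rev[OF e(1)]] .
        then show ?thesis using e(2) less.IH[of k e1] 3 by simp
      qed
    qed
  qed
  have walk: "(e, e') \<in> T\<^sup>* \<or> (e', e) \<in> T\<^sup>*" if "(e, e') \<in> (T \<union> T\<inverse>)\<^sup>*" for e e'
    using that
  proof induction
    case base then show ?case by simp
  next
    case (step y z)
    have f: "(e, z) \<in> T\<^sup>* \<or> (z, e) \<in> T\<^sup>*" if "(e, y) \<in> T\<^sup>*" "(z, y) \<in> T"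
      using that(1)
    proof (cases rule: rtranclE)
      case base then show ?thesis using that(2) by blast
    next
      case (step w) then show ?thesis using that(2) det' by metis
    qed
    have b: "(e, z) \<in> T\<^sup>* \<or> (z, e) \<in> T\<^sup>*" if "(y, e) \<in> T\<^sup>*" "(y, z) \<in> T"
      using that(1)
    proof (cases rule: converse_rtranclE)
      case base then show ?thesis using that(2) by blast
    next
      case (step w) then show ?thesis using that(2) det by metis
    qed
    from step show ?case
      using f b by (auto intro: rtrancl_into_rtrancl converse_rtrancl_into_rtrancl)
  qed
  (* The class of e under walking in either direction; the two classes belonging to an edge differ,
     so that one of them can be chosen. *)
  define C where "C e = (T \<union> T\<inverse>)\<^sup>* `` {e}" for e
  have CT: "C e = C e'" if "(e, e') \<in> T" for e e'
  proof -
    have "(e, e') \<in> (T \<union> T\<inverse>)\<^sup>*" "(e', e) \<in> (T \<union> T\<inverse>)\<^sup>*" using that by auto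
    then show ?thesis unfolding C_def by (auto intro: rtrancl_trans)
  qed
  have C\<iota>: "C e \<noteq> C (\<iota> e)" for e
  proof
    assume "C e = C (\<iota> e)"
    then have "(e, \<iota> e) \<in> (T \<union> T\<inverse>)\<^sup>*" by (auto simp: C_def)
    then have "(e, \<iota> e) \<in> T\<^sup>* \<or> (\<iota> e, e) \<in> T\<^sup>*" by (rule walk)
    then show False using noturns invol by (metis rtrancl_imp_relpow)
  qed
  define chosen where "chosen = {e. C e = (SOME c. c \<in> {C e, C (\<iota> e)})}"
  have "(e \<in> chosen) \<noteq> (\<iota> e \<in> chosen)" for e
  proof -
    define c0 where "c0 = (SOME c. c \<in> {C e, C (\<iota> e)})"
    have "c0 \<in> {C e, C (\<iota> e)}" unfolding c0_def by (rule someI[of _ "C e"]) simp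
    moreover have "e \<in> chosen \<longleftrightarrow> C e = c0" by (simp add: chosen_def c0_def)
    moreover have "\<iota> e \<in> chosen \<longleftrightarrow> C (\<iota> e) = c0"
      unfolding chosen_def c0_def mem_Collect_eq invol insert_commute[of "C (\<iota> e)"] ..
    ultimately show ?thesis using C\<iota>[of e] by auto
  qed
  moreover have "e \<in> chosen \<longleftrightarrow> e' \<in> chosen" if "(e, e') \<in> T" for e e'
    using CT[OF that] CT[OF rev[OF that]] by (simp add: chosen_def)
  ultimately show ?thesis by blast
qed

text \<open>Call a half-edge \<open>(x, s)\<close> escaping if \<open>x \<in> E s\<close>. By hypothesis a path that starts with an escaping
half-edge goes on escaping as long as it does not turn back, and \<open>h\<close> grows along it. Hence every
vertex can claim an escaping edge, and no edge is claimed from both ends. In the other direction an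
escaping edge is assigned to its far end, where no other escaping edge arrives. The edges that escape
in neither direction form a graph in which every vertex has at most two edges, and whose vertices are
not far ends of escaping edges; a direction along each of its lines and cycles assigns these edges as
well. A point fixed by a nontrivial reduced word gives a closed path, which has to run through such a
cycle, and this is why fixed points do no harm.\<close>

lemma labelling_if_escaping:
  fixes act :: "letter \<Rightarrow> 'x \<Rightarrow> 'x" and E :: "letter \<Rightarrow> 'x set" and h :: "'x \<Rightarrow> real"
  assumes inv: "\<And>s x. act (linv s) (act s x) = x"
    and esc: "\<And>s t x. x \<in> E s \<Longrightarrow> t \<noteq> linv s \<Longrightarrow> act s x \<in> E t"
    and mono: "\<And>s x. x \<in> E s \<Longrightarrow> h x < h (act s x)"
    and three: "\<And>s t u x. s \<noteq> t \<Longrightarrow> t \<noteq> u \<Longrightarrow> s \<noteq> u \<Longrightarrow> x \<in> E s \<union> E t \<union> E u"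
  shows "\<exists>l. \<forall>x s. (l x = s) \<noteq> (l (act s x) = linv s)"
proof -
  have both: "act s x \<notin> E (linv s)" if "x \<in> E s" for s x
    using mono[OF that] mono[of "act s x" "linv s"] inv[of s x] by auto
  define \<iota> where "\<iota> = (\<lambda>(x, s). (act s x, linv s))"
  define H where "H = {(x, s). x \<notin> E s \<and> act s x \<notin> E (linv s)}"
  define T where "T = {((x, s), (act s x, t)) |x s t. (x, s) \<in> H \<and> (act s x, t) \<in> H \<and> t \<noteq> linv s}"
  have TI: "((x, s), (act s x, t)) \<in> T" if "(x, s) \<in> H" "(act s x, t) \<in> H" "t \<noteq> linv s" for x s t
    unfolding T_def using that by blast
  have TE: "\<exists>t. e' = (act s x, t) \<and> (x, s) \<in> H \<and> e' \<in> H \<and> t \<noteq> linv s"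
    if "((x, s), e') \<in> T" for x s e'
    using that unfolding T_def by fast
  have invol: "\<iota> (\<iota> e) = e" for e by (cases e) (simp add: \<iota>_def inv)
  have nofix: "\<iota> e \<noteq> e" for e by (cases e) (simp add: \<iota>_def)
  have H\<iota>: "e \<in> H \<Longrightarrow> \<iota> e \<in> H" for e by (cases e) (simp add: \<iota>_def H_def inv)
  have rev: "(\<iota> e', \<iota> e) \<in> T" if eT: "(e, e') \<in> T" for e e'
  proof -
    obtain x s t where e: "e = (x, s)" "e' = (act s x, t)" "e \<in> H" "e' \<in> H" "t \<noteq> linv s"
      using eT by (auto simp: T_def)
    have i: "\<iota> e' = (act t (act s x), linv t)" "\<iota> e = (act (linv t) (act t (act s x)), linv s)"
      by (simp_all add: e \<iota>_def inv)
    have ne: "linv s \<noteq> linv (linv t)" using e(5) by auto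
    show ?thesis
      using TI[OF H\<iota>[OF e(4), unfolded i] H\<iota>[OF e(3), unfolded i] ne] unfolding i .
  qed
  have det: "e1 = e2" if d1: "(e, e1) \<in> T" and d2: "(e, e2) \<in> T" for e e1 e2
  proof -
    obtain x s where e: "e = (x, s)" by (cases e)
    obtain t1 where t1: "e1 = (act s x, t1)" "(x, s) \<in> H" "e1 \<in> H" "t1 \<noteq> linv s"
      using TE[OF d1[unfolded e]] by blast
    obtain t2 where t2: "e2 = (act s x, t2)" "e2 \<in> H" "t2 \<noteq> linv s"
      using TE[OF d2[unfolded e]] by blast
    from t1 t2 show ?thesis using three[of t1 t2 "linv s" "act s x"] by (auto simp: H_def)
  qed
  have noturn: "(e, \<iota> e) \<notin> T" for e by (auto simp: T_def \<iota>_def)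
  have "\<exists>chosen. (\<forall>e. (e \<in> chosen) \<noteq> (\<iota> e \<in> chosen)) \<and> (\<forall>e e'. (e, e') \<in> T \<longrightarrow> (e \<in> chosen \<longleftrightarrow> e' \<in> chosen))"
    by (rule orientation_exists, rule invol, rule nofix, erule rev, erule (1) det, rule noturn)
  then obtain chosen where chosen: "\<forall>e. (e \<in> chosen) \<noteq> (\<iota> e \<in> chosen)"
      "\<forall>e e'. (e, e') \<in> T \<longrightarrow> (e \<in> chosen \<longleftrightarrow> e' \<in> chosen)"
    by (elim exE conjE)
  define D where "D x s = (x \<notin> E s \<and> (act s x \<in> E (linv s) \<or> (x, s) \<in> chosen))" for x s
  define f where "f x = (SOME s. x \<in> E s)" for x
  have f: "x \<in> E (f x)" for x
    unfolding f_def
    using three[of "Letter False False" "Letter False True" "Letter True False" x] by (metis Un_iff letter.inject someI)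
  have D1: "D x s \<noteq> D (act s x) (linv s)" for x s
    using both[of x s] both[of "act s x" "linv s"] chosen(1)[rule_format, of "(x, s)"] inv[of s x]
    by (auto simp: D_def \<iota>_def)
  have D2: "s = t" if d: "D x s" "D x t" for x s t
  proof (rule ccontr)
    assume ne: "s \<noteq> t"
    have n: "x \<notin> E s" "x \<notin> E t" using d by (auto simp: D_def)
    have ns: "act s x \<notin> E (linv s)" using esc[of "act s x" "linv s" t] n ne inv[of s x] by auto
    have nt: "act t x \<notin> E (linv t)" using esc[of "act t x" "linv t" s] n ne inv[of t x] by auto
    have "(\<iota> (x, s), (x, t)) \<in> T"
      using TI[of "act s x" "linv s" t] n ns nt ne inv[of s x] by (simp add: \<iota>_def H_def)
    moreover have "(x, s) \<in> chosen" "(x, t) \<in> chosen" using d ns nt by (auto simp: D_def)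
    moreover have "((x, s) \<in> chosen) \<noteq> (\<iota> (x, s) \<in> chosen)" using chosen(1) by (rule spec)
    ultimately show False using chosen(2) by metis
  qed
  have "f (act (f x) x) \<noteq> linv (f x)" for x
    using both[OF f[of x]] f[of "act (f x) x"] by metis
  then show ?thesis
    by (intro labelling_if_two_injections[of act f D] inv D1) (auto intro: D2)
qed

section \<open>Absolute values on subrings and seminorms extending them\<close>

text \<open>The absolute value only has to make sense on the subring: outside \<open>S\<close> the values of \<open>\<alpha>\<close>
are arbitrary.\<close>

definition subring_abs :: "'k::field set \<Rightarrow> ('k \<Rightarrow> real) \<Rightarrow> bool" where
  "subring_abs S \<alpha> \<longleftrightarrow>
     1 \<in> S \<and> (\<forall>x\<in>S. \<forall>y\<in>S. x - y \<in> S \<and> x * y \<in> S) \<and>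
     (\<forall>x\<in>S. \<alpha> x \<ge> 0 \<and> (\<alpha> x = 0 \<longleftrightarrow> x = 0)) \<and>
     (\<forall>x\<in>S. \<forall>y\<in>S. \<alpha> (x * y) = \<alpha> x * \<alpha> y \<and> \<alpha> (x + y) \<le> \<alpha> x + \<alpha> y)"

lemma subring_absD:
  assumes "subring_abs S \<alpha>"
  shows subring_abs_1: "1 \<in> S" and subring_abs_0: "0 \<in> S"
    and subring_abs_diff: "\<And>x y. x \<in> S \<Longrightarrow> y \<in> S \<Longrightarrow> x - y \<in> S"
    and subring_abs_uminus: "\<And>x. x \<in> S \<Longrightarrow> - x \<in> S"
    and subring_abs_add: "\<And>x y. x \<in> S \<Longrightarrow> y \<in> S \<Longrightarrow> x + y \<in> S"
    and subring_abs_mult: "\<And>x y. x \<in> S \<Longrightarrow> y \<in> S \<Longrightarrow> x * y \<in> S"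
    and subring_abs_power: "\<And>x n. x \<in> S \<Longrightarrow> x ^ n \<in> S"
    and subring_abs_nonneg: "\<And>x. x \<in> S \<Longrightarrow> \<alpha> x \<ge> 0"
    and subring_abs_zero_iff: "\<And>x. x \<in> S \<Longrightarrow> \<alpha> x = 0 \<longleftrightarrow> x = 0"
    and subring_abs_times: "\<And>x y. x \<in> S \<Longrightarrow> y \<in> S \<Longrightarrow> \<alpha> (x * y) = \<alpha> x * \<alpha> y"
    and subring_abs_triangle: "\<And>x y. x \<in> S \<Longrightarrow> y \<in> S \<Longrightarrow> \<alpha> (x + y) \<le> \<alpha> x + \<alpha> y"
    and subring_abs_one: "\<alpha> 1 = 1"
    and subring_abs_minus_one: "\<alpha> (- 1) = 1"
    and subring_abs_of_power: "\<And>x n. x \<in> S \<Longrightarrow> \<alpha> (x ^ n) = \<alpha> x ^ n"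
proof -
  have d: "x - y \<in> S" "x * y \<in> S" if "x \<in> S" "y \<in> S" for x y
    using assms that unfolding subring_abs_def by blast+
  have nn: "\<alpha> x \<ge> 0" "\<alpha> x = 0 \<longleftrightarrow> x = 0" if "x \<in> S" for x
    using assms that unfolding subring_abs_def by blast+
  have m: "\<alpha> (x * y) = \<alpha> x * \<alpha> y" "\<alpha> (x + y) \<le> \<alpha> x + \<alpha> y" if "x \<in> S" "y \<in> S" for x y
    using assms that unfolding subring_abs_def by blast+
  show 1: "1 \<in> S" using assms unfolding subring_abs_def by blast
  show 0: "0 \<in> S" using d(1)[OF 1 1] by simp
  have um: "- x \<in> S" if "x \<in> S" for x using d(1)[OF 0 that] by simp
  show "x - y \<in> S" "x * y \<in> S" "x + y \<in> S" if "x \<in> S" "y \<in> S" for x y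
    using d[OF that] d(1)[OF that(1) um[OF that(2)]] by simp_all
  have pw: "x ^ n \<in> S" if "x \<in> S" for x n using that by (induction n) (auto simp: 1 d)
  show "- x \<in> S" "x ^ n \<in> S" "\<alpha> x \<ge> 0" "\<alpha> x = 0 \<longleftrightarrow> x = 0" if "x \<in> S" for x n
    using um pw nn that by blast+
  show "\<alpha> (x * y) = \<alpha> x * \<alpha> y" "\<alpha> (x + y) \<le> \<alpha> x + \<alpha> y" if "x \<in> S" "y \<in> S" for x y
    using m that by blast+
  have "\<alpha> 1 * \<alpha> 1 = \<alpha> 1" using m(1)[OF 1 1] by simp
  then show one: "\<alpha> 1 = 1" using nn(2)[OF 1] by simp
  have "\<alpha> (- 1) * \<alpha> (- 1) = 1" using m(1)[OF um[OF 1] um[OF 1]] one by simp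
  then show "\<alpha> (- 1) = 1" using nn(1)[OF um[OF 1]] by (simp add: square_eq_1_iff) 
  show "\<alpha> (x ^ n) = \<alpha> x ^ n" if "x \<in> S" for x n
    by (induction n) (auto simp: one m(1)[OF that pw[OF that]])
qed

text \<open>Up to denominators, \<open>W\<close> is a complement of the fraction field of \<open>S\<close> in the vector space \<open>'k\<close> over
it. It is an \<open>S\<close>-submodule maximal among those that meet \<open>S\<close> only in zero.\<close>

lemma complement_submodule_exists:
  fixes S :: "'k::field set"
  assumes S: "subring_abs S \<alpha>"
  shows "\<exists>W. 0 \<in> W \<and> (\<forall>x\<in>W. \<forall>y\<in>W. x + y \<in> W) \<and> (\<forall>c\<in>S. \<forall>x\<in>W. c * x \<in> W) \<and> W \<inter> S = {0} \<and>
      (\<forall>x. \<exists>c\<in>S. \<exists>s\<in>S. c \<noteq> 0 \<and> c * x - s \<in> W)"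
proof -
  let ?P = "\<lambda>W. 0 \<in> W \<and> (\<forall>x\<in>W. \<forall>y\<in>W. x + y \<in> W) \<and> (\<forall>c\<in>S. \<forall>x\<in>W. c * x \<in> W) \<and> W \<inter> S = {0}"
  have "\<exists>M\<in>Collect ?P. \<forall>X\<in>Collect ?P. M \<subseteq> X \<longrightarrow> X = M"
  proof (rule subset_Zorn_nonempty)
    have "{0} \<in> Collect ?P" using subring_abs_0[OF S] by simp
    then show "Collect ?P \<noteq> {}" by (metis empty_iff)
  next
    fix C assume C: "C \<noteq> {}" "subset.chain (Collect ?P) C"
    have sub: "C \<subseteq> Collect ?P" and chain: "\<forall>x\<in>C. \<forall>y\<in>C. x \<subseteq> y \<or> y \<subseteq> x"
      using C(2) unfolding subset_chain_def by simp_all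
    have P: "?P W" if "W \<in> C" for W
      using subsetD[OF sub that] by (rule CollectD)
    have P0: "0 \<in> W" and Padd: "\<And>x y. x \<in> W \<Longrightarrow> y \<in> W \<Longrightarrow> x + y \<in> W"
      and Pmul: "\<And>c x. c \<in> S \<Longrightarrow> x \<in> W \<Longrightarrow> c * x \<in> W" and PS: "W \<inter> S = {0}" if "W \<in> C" for W
      using P[OF that] by simp_all
    have "x + y \<in> \<Union>C" if xy: "x \<in> \<Union>C" "y \<in> \<Union>C" for x y
    proof -
      obtain U V where UV: "x \<in> U" "U \<in> C" "y \<in> V" "V \<in> C" using xy by blast
      have "U \<subseteq> V \<or> V \<subseteq> U" using chain UV(2,4) by blast
      then show ?thesis
      proof
        assume "U \<subseteq> V" then show ?thesis using UV Padd[OF UV(4)] by blast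
      next
        assume "V \<subseteq> U" then show ?thesis using UV Padd[OF UV(2)] by blast
      qed
    qed
    moreover have "0 \<in> \<Union>C" using C(1) P0 by blast
    moreover have "c * x \<in> \<Union>C" if "c \<in> S" "x \<in> \<Union>C" for c x using that Pmul by blast
    moreover have "\<Union>C \<inter> S = {0}"
      using PS C(1) unfolding Int_Union2 by simp
    ultimately show "\<Union>C \<in> Collect ?P" by (intro CollectI conjI ballI)
  qed
  then obtain W where "W \<in> Collect ?P" and max': "\<forall>X\<in>Collect ?P. W \<subseteq> X \<longrightarrow> X = W" by (elim bexE)
  then have W: "?P W" by simp
  then have W0: "0 \<in> W" and Wadd: "\<And>x y. x \<in> W \<Longrightarrow> y \<in> W \<Longrightarrow> x + y \<in> W"
    and Wmul: "\<And>c x. c \<in> S \<Longrightarrow> x \<in> W \<Longrightarrow> c * x \<in> W" and WS: "W \<inter> S = {0}"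
    by simp_all
  have "\<exists>c\<in>S. \<exists>s\<in>S. c \<noteq> 0 \<and> c * x - s \<in> W" for x
  proof (cases "x \<in> W")
    case True
    then show ?thesis using subring_abs_1[OF S] subring_abs_0[OF S]
      by (intro bexI[of _ 1] bexI[of _ 0]) auto
  next
    case False
    define X where "X = {w + c * x |w c. w \<in> W \<and> c \<in> S}"
    have sub: "W \<subseteq> X" using subring_abs_0[OF S] by (force simp: X_def)
    have xX: "x \<in> X" unfolding X_def using W0 subring_abs_1[OF S] by force
    have "X \<noteq> W" using False xX by blast
    have "\<exists>z\<in>X. z \<in> S \<and> z \<noteq> 0"
    proof (rule ccontr)
      assume "\<not> ?thesis"
      moreover have X0: "0 \<in> X" using W0 sub by blast
      ultimately have "X \<inter> S = {0}" using subring_abs_0[OF S] by blast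
      moreover have "y + z \<in> X" if yz: "y \<in> X" "z \<in> X" for y z
      proof -
        obtain w c w' c' where "y = w + c * x" "z = w' + c' * x" "w \<in> W" "w' \<in> W" "c \<in> S" "c' \<in> S"
          using yz unfolding X_def by blast
        then have "y + z = (w + w') + (c + c') * x" "w + w' \<in> W" "c + c' \<in> S"
          using Wadd subring_abs_add[OF S] by (simp_all add: algebra_simps)
        then show ?thesis unfolding X_def by blast
      qed
      moreover have "d * y \<in> X" if dy: "d \<in> S" "y \<in> X" for d y
      proof -
        obtain w c where "y = w + c * x" "w \<in> W" "c \<in> S"
          using dy unfolding X_def by blast
        then have "d * y = d * w + (d * c) * x" "d * w \<in> W" "d * c \<in> S"
          using Wmul dy(1) subring_abs_mult[OF S] by (simp_all add: algebra_simps)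
        then show ?thesis unfolding X_def by blast
      qed
      ultimately have "X \<in> Collect ?P" using X0 by (intro CollectI conjI ballI)
      then show False using max' sub \<open>X \<noteq> W\<close> by blast
    qed
    then obtain w c where wc: "w \<in> W" "c \<in> S" "w + c * x \<in> S" "w + c * x \<noteq> 0"
      unfolding X_def by blast
    have "c \<noteq> 0"
    proof
      assume "c = 0"
      then have "w \<in> W \<inter> S" "w \<noteq> 0" using wc by simp_all
      then show False using WS by blast
    qed
    moreover have "c * x - (w + c * x) = (- 1) * w" by simp
    moreover have "(- 1) * w \<in> W" by (intro Wmul wc(1) subring_abs_uminus[OF S] subring_abs_1[OF S])
    ultimately show ?thesis using wc(2,3) by (intro bexI[of _ c] bexI[of _ "w + c * x"] conjI) simp_all
  qed
  then show ?thesis using W by (intro exI[of _ W] conjI allI) simp_all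
qed

text \<open>In general the absolute value cannot be extended multiplicatively from \<open>S\<close> to the field: the usual
one on the integers does not extend to a field of larger cardinality than the complex numbers. A seminorm
suffices, and it is the absolute value of the component in the fraction field of \<open>S\<close> along the
complement \<open>W\<close>: if \<open>c * x - s \<in> W\<close> then \<open>x\<close> has component \<open>s / c\<close>.\<close>

lemma seminorm_extending_subring_abs:
  fixes S :: "'k::field set"
  assumes S: "subring_abs S \<alpha>"
  shows "\<exists>\<beta> :: 'k \<Rightarrow> real. (\<forall>x. \<beta> x \<ge> 0) \<and> (\<forall>x y. \<beta> (x + y) \<le> \<beta> x + \<beta> y) \<and>
    (\<forall>c\<in>S. \<forall>x. \<beta> (c * x) = \<alpha> c * \<beta> x) \<and> \<beta> 1 = 1"
proof -
  obtain W where W0: "0 \<in> W" and Wadd: "\<And>x y. x \<in> W \<Longrightarrow> y \<in> W \<Longrightarrow> x + y \<in> W"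
    and Wmul: "\<And>c x. c \<in> S \<Longrightarrow> x \<in> W \<Longrightarrow> c * x \<in> W" and WS: "W \<inter> S = {0}"
    and Wex: "\<And>x. \<exists>c\<in>S. \<exists>s\<in>S. c \<noteq> 0 \<and> c * x - s \<in> W"
    using complement_submodule_exists[OF S] by (elim exE conjE) simp
  have Wdiff: "x - y \<in> W" if "x \<in> W" "y \<in> W" for x y
  proof -
    have "x + (- 1) * y \<in> W"
      using that by (intro Wadd Wmul subring_abs_uminus[OF S] subring_abs_1[OF S])
    then show ?thesis by simp
  qed
  define rel where "rel x c s \<longleftrightarrow> c \<in> S \<and> s \<in> S \<and> c \<noteq> 0 \<and> c * x - s \<in> W" for x c s
  obtain c s where cs: "\<And>x. rel x (c x) (s x)" using Wex unfolding rel_def by metis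
  define \<beta> where "\<beta> x = \<alpha> (s x) / \<alpha> (c x)" for x
  have pos: "\<alpha> c' > 0" if "rel x c' s'" for x c' s'
    using that subring_abs_nonneg[OF S, of c'] subring_abs_zero_iff[OF S, of c'] by (simp add: rel_def)
  have \<beta>: "\<beta> x = \<alpha> s' / \<alpha> c'" if r: "rel x c' s'" for x c' s'
  proof -
    have in_S: "c' \<in> S" "s' \<in> S" "c x \<in> S" "s x \<in> S" using r cs[of x] by (auto simp: rel_def)
    have "c' * (c x * x - s x) - c x * (c' * x - s') \<in> W"
      using r cs[of x] unfolding rel_def by (intro Wdiff[OF Wmul Wmul]) auto
    then have "c x * s' - c' * s x \<in> W" by (simp add: algebra_simps)
    moreover have "c x * s' - c' * s x \<in> S"
      using in_S by (intro subring_abs_diff[OF S] subring_abs_mult[OF S])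
    ultimately have "c x * s' - c' * s x \<in> W \<inter> S" by blast
    then have "c x * s' = c' * s x" unfolding WS by simp
    then have "\<alpha> (c x) * \<alpha> s' = \<alpha> c' * \<alpha> (s x)"
      using subring_abs_times[OF S] in_S by metis
    then show ?thesis unfolding \<beta>_def using pos[OF r] pos[OF cs[of x]]
      by (simp add: field_simps)
  qed
  show ?thesis
  proof (intro exI[of _ \<beta>] conjI allI ballI)
    show "\<beta> x \<ge> 0" for x
      using cs[of x] subring_abs_nonneg[OF S] by (auto simp: \<beta>_def rel_def)
    have "rel 1 1 1" using W0 subring_abs_1[OF S] by (simp add: rel_def)
    from \<beta>[OF this] show "\<beta> 1 = 1" by (simp add: subring_abs_one[OF S])
    show "\<beta> (d * x) = \<alpha> d * \<beta> x" if d: "d \<in> S" for d x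
    proof -
      have in_S: "c x \<in> S" "s x \<in> S" using cs[of x] by (auto simp: rel_def)
      have "d * (c x * x - s x) \<in> W" using cs[of x] d by (intro Wmul) (auto simp: rel_def)
      then have "rel (d * x) (c x) (d * s x)"
        using cs[of x] d subring_abs_mult[OF S] by (auto simp: rel_def algebra_simps)
      from \<beta>[OF this] show ?thesis using subring_abs_times[OF S d in_S(2)] by (simp add: \<beta>_def)
    qed
    show "\<beta> (x + y) \<le> \<beta> x + \<beta> y" for x y
    proof -
      have in_S: "c x \<in> S" "s x \<in> S" "c y \<in> S" "s y \<in> S"
        using cs[of x] cs[of y] by (auto simp: rel_def)
      have "c y * (c x * x - s x) + c x * (c y * y - s y) \<in> W"
        using cs[of x] cs[of y] unfolding rel_def by (intro Wadd[OF Wmul Wmul]) auto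
      then have "rel (x + y) (c x * c y) (c y * s x + c x * s y)"
        using cs[of x] cs[of y] subring_abs_mult[OF S] subring_abs_add[OF S]
        by (auto simp: rel_def algebra_simps)
      from \<beta>[OF this] have "\<beta> (x + y) = \<alpha> (c y * s x + c x * s y) / (\<alpha> (c x) * \<alpha> (c y))"
        using subring_abs_times[OF S] in_S by simp
      also have "\<dots> \<le> (\<alpha> (c y) * \<alpha> (s x) + \<alpha> (c x) * \<alpha> (s y)) / (\<alpha> (c x) * \<alpha> (c y))"
        using subring_abs_triangle[OF S, of "c y * s x" "c x * s y"] subring_abs_times[OF S]
          subring_abs_mult[OF S] in_S pos[OF cs[of x]] pos[OF cs[of y]]
        by (intro divide_right_mono) auto
      also have "\<dots> = \<beta> x + \<beta> y"
        unfolding \<beta>_def using pos[OF cs[of x]] pos[OF cs[of y]] by (simp add: field_simps)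
      finally show ?thesis .
    qed
  qed
qed

section \<open>A second absolute value in which a small element is large\<close>

lemma na_valuationD:
  assumes "na_valuation v"
  shows na_val_nonneg: "\<And>x. v x \<ge> 0" and na_val_zero_iff: "\<And>x. v x = 0 \<longleftrightarrow> x = 0"
    and na_val_mult: "\<And>x y. v (x * y) = v x * v y"
    and na_val_add: "\<And>x y. v (x + y) \<le> max (v x) (v y)"
    and na_val_one: "v 1 = 1" and na_val_minus: "\<And>x. v (- x) = v x"
    and na_val_power: "\<And>x n. v (x ^ n) = v x ^ n"
    and na_val_inverse: "\<And>x. v (inverse x) = inverse (v x)"
    and na_val_divide: "\<And>x y. v (x / y) = v x / v y"
proof -
  show nn: "v x \<ge> 0" "v x = 0 \<longleftrightarrow> x = 0" "v (x * y) = v x * v y" "v (x + y) \<le> max (v x) (v y)" for x y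
    using assms unfolding na_valuation_def by blast+
  have "v 1 * v 1 = v 1" using nn(3)[of 1 1] by simp
  then show 1: "v 1 = 1" using nn(2)[of 1] by simp
  have "v (- 1) * v (- 1) = 1" using nn(3)[of "- 1" "- 1"] 1 by simp
  then have m1: "v (- 1) = 1" using nn(1)[of "- 1"] by (simp add: square_eq_1_iff)
  show "v (- x) = v x" for x using nn(3)[of "- 1" x] m1 by simp
  show "v (x ^ n) = v x ^ n" for x n by (induction n) (auto simp: 1 nn)
  show i: "v (inverse x) = inverse (v x)" for x
  proof (cases "x = 0")
    case False
    then have "v x * v (inverse x) = 1" using nn(3)[of x "inverse x"] 1 by simp
    then show ?thesis by (metis inverse_unique)
  qed (use nn(2)[of 0] in simp)
  show "v (x / y) = v x / v y" for x y by (simp add: divide_inverse nn(3) i)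
qed

lemma na_val_add_eq:
  assumes "na_valuation v" "v y < v x"
  shows "v (x + y) = v x"
proof (rule antisym)
  show "v (x + y) \<le> v x" using na_val_add[OF assms(1), of x y] assms(2) by simp
  show "v x \<le> v (x + y)"
    using na_val_add[OF assms(1), of "x + y" "- y"] assms(2) na_val_minus[OF assms(1), of y] by auto
qed

lemma na_val_of_int_le_1:
  assumes v: "na_valuation v"
  shows "v (of_int n) \<le> 1"
proof -
  have "v (of_nat m) \<le> 1" for m
  proof (induction m)
    case (Suc m)
    then show ?case using na_val_add[OF v, of 1 "of_nat m"] na_val_one[OF v] by (auto split: if_splits)
  qed (use na_val_zero_iff[OF v, of 0] in simp)
  then show ?thesis
    by (cases n) (auto simp: na_val_minus[OF v] simp del: of_nat_Suc of_nat_add)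
qed

text \<open>A polynomial whose nonzero coefficients have value 1 is dominated at \<open>\<pi>\<close> by its lowest term,
so that \<open>\<pi>\<close> is transcendental over the prime ring.\<close>

lemma poly_nonzero_at_small:
  fixes v :: "'k::field \<Rightarrow> real"
  assumes v: "na_valuation v" and \<pi>: "v \<pi> < 1"
    and triv: "\<And>n. of_int n \<noteq> (0::'k) \<Longrightarrow> v (of_int n) = 1"
    and p: "\<forall>i. coeff p i \<in> \<int>"
    and root: "poly p \<pi> = 0" "\<pi> \<noteq> 0"
  shows "p = 0"
proof -
  have "v (poly p \<pi>) \<le> 1 \<and> (poly p \<pi> = 0 \<longrightarrow> \<pi> \<noteq> 0 \<longrightarrow> p = 0)"
    using p
  proof (induction p)
    case 0 then show ?case using na_val_zero_iff[OF v, of 0] by simp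
  next
    case (pCons a p)
    obtain n where n: "a = of_int n" using pCons.prems by (metis coeff_pCons_0 Ints_cases)
    have "\<forall>i. coeff p i \<in> \<int>" using pCons.prems by (metis coeff_pCons_Suc)
    note IH = pCons.IH[OF this]
    have small: "v (\<pi> * poly p \<pi>) < 1"
    proof -
      have "v (\<pi> * poly p \<pi>) \<le> v \<pi> * 1"
        unfolding na_val_mult[OF v] by (rule mult_left_mono) (use IH na_val_nonneg[OF v] in auto)
      then show ?thesis using \<pi> by simp
    qed
    have "v (a + \<pi> * poly p \<pi>) \<le> 1"
      using na_val_add[OF v, of a "\<pi> * poly p \<pi>"] small na_val_of_int_le_1[OF v, of n] n by auto
    moreover have "pCons a p = 0" if z: "a + \<pi> * poly p \<pi> = 0" and "\<pi> \<noteq> 0"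
    proof -
      have "a = 0"
      proof (rule ccontr)
        assume "a \<noteq> 0"
        then have "v a = 1" using triv n by blast
        then have "v (a + \<pi> * poly p \<pi>) = 1" using na_val_add_eq[OF v, of "\<pi> * poly p \<pi>" a] small by simp
        then show False using z na_val_zero_iff[OF v, of 0] by simp
      qed
      then show ?thesis using z IH \<open>\<pi> \<noteq> 0\<close> by simp
    qed
    ultimately show ?case by simp
  qed
  then show ?thesis using root by blast
qed

definition int_polys :: "'k::field poly set" where
  "int_polys = {p. \<forall>i. coeff p i \<in> \<int>}"

lemma int_polys_closed:
  shows "1 \<in> int_polys" "[:0, 1:] \<in> int_polys"
    and "\<And>p q. p \<in> int_polys \<Longrightarrow> q \<in> int_polys \<Longrightarrow> p - q \<in> int_polys"
    and "\<And>p q. p \<in> int_polys \<Longrightarrow> q \<in> int_polys \<Longrightarrow> p * q \<in> int_polys"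
    and "\<And>p q. p \<in> int_polys \<Longrightarrow> q \<in> int_polys \<Longrightarrow> p + q \<in> int_polys"
proof -
  show "1 \<in> int_polys" "[:0, 1:] \<in> int_polys"
    by (auto simp: int_polys_def coeff_pCons one_pCons split: nat.splits)
  show "p - q \<in> int_polys" if "p \<in> int_polys" "q \<in> int_polys" for p q
    using that by (simp add: int_polys_def)
  show "p + q \<in> int_polys" if "p \<in> int_polys" "q \<in> int_polys" for p q
    using that by (simp add: int_polys_def)
  show "p * q \<in> int_polys" if "p \<in> int_polys" "q \<in> int_polys" for p q
    using that by (simp add: int_polys_def coeff_mult Ints_sum)
qed

text \<open>If the valuation is trivial on the integers, then \<open>\<pi>\<close> behaves like an indeterminate over the prime
ring, and the degree in \<open>\<pi>\<close> gives an absolute value in which \<open>\<pi>\<close> is large although \<open>v \<pi>\<close> is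
small.\<close>

lemma two_absolute_values_trivial_on_int:
  fixes v :: "'k::field \<Rightarrow> real"
  assumes v: "na_valuation v" and nontriv: "\<not> trivial_valuation v"
    and triv: "\<And>n. of_int n \<noteq> (0::'k) \<Longrightarrow> v (of_int n) = 1"
  shows "\<exists>S \<alpha> \<pi>. subring_abs S \<alpha> \<and> \<pi> \<in> S \<and> 0 < v \<pi> \<and> v \<pi> < 1 \<and> 1 < \<alpha> \<pi>"
proof -
  obtain x where x: "x \<noteq> 0" "v x \<noteq> 1" using nontriv by (auto simp: trivial_valuation_def)
  have vx: "v x > 0" using x na_val_zero_iff[OF v] na_val_nonneg[OF v] by (metis less_eq_real_def)
  obtain \<pi> where \<pi>: "0 < v \<pi>" "v \<pi> < 1"
  proof (cases "v x < 1")
    case True then show ?thesis using vx that by blast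
  next
    case False
    then have "v (inverse x) < 1" "0 < v (inverse x)"
      using x vx by (auto simp: na_val_inverse[OF v] inverse_less_1_iff)
    then show ?thesis using that by blast
  qed
  have \<pi>0: "\<pi> \<noteq> 0" using \<pi>(1) na_val_zero_iff[OF v, of \<pi>] by auto
  define deg where "deg y = degree (THE p. p \<in> int_polys \<and> poly p \<pi> = y)" for y
  define \<alpha> where "\<alpha> y = (if y = 0 then 0 else 2 ^ deg y :: real)" for y
  define S where "S = (\<lambda>p. poly p \<pi>) ` int_polys"
  have inj: "p = q" if "p \<in> int_polys" "q \<in> int_polys" "poly p \<pi> = poly q \<pi>" for p q
    using poly_nonzero_at_small[OF v \<pi>(2) triv, of "p - q"] int_polys_closed(3)[OF that(1,2)] that(3) \<pi>0
    by (simp add: int_polys_def)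
  have deg: "deg (poly p \<pi>) = degree p" if "p \<in> int_polys" for p
  proof -
    have "(THE q. q \<in> int_polys \<and> poly q \<pi> = poly p \<pi>) = p"
      using that inj by (intro the_equality) auto
    then show ?thesis by (simp add: deg_def)
  qed
  have zero: "poly p \<pi> = 0 \<longleftrightarrow> p = 0" if "p \<in> int_polys" for p
    using poly_nonzero_at_small[OF v \<pi>(2) triv, of p] that \<pi>0 by (auto simp: int_polys_def)
  have \<alpha>: "\<alpha> (poly p \<pi>) = (if p = 0 then 0 else 2 ^ degree p)" if "p \<in> int_polys" for p
    using deg[OF that] zero[OF that] by (simp add: \<alpha>_def)
  have "subring_abs S \<alpha>"
    unfolding subring_abs_def
  proof (intro conjI ballI)
    show "1 \<in> S" unfolding S_def using int_polys_closed(1) by (intro image_eqI[of _ _ 1]) auto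
    fix x assume "x \<in> S"
    then obtain p where p: "p \<in> int_polys" "x = poly p \<pi>" by (auto simp: S_def)
    show "0 \<le> \<alpha> x" "\<alpha> x = 0 \<longleftrightarrow> x = 0" by (simp_all add: \<alpha>_def)
    fix y assume "y \<in> S"
    then obtain q where q: "q \<in> int_polys" "y = poly q \<pi>" by (auto simp: S_def)
    note pq = int_polys_closed(3-5)[OF p(1) q(1)]
    show "x - y \<in> S" unfolding S_def p q using pq(1) by (intro image_eqI[of _ _ "p - q"]) auto
    show "x * y \<in> S" unfolding S_def p q using pq(2) by (intro image_eqI[of _ _ "p * q"]) auto
    show "\<alpha> (x * y) = \<alpha> x * \<alpha> y"
      using \<alpha>[OF p(1)] \<alpha>[OF q(1)] \<alpha>[OF pq(2)] by (auto simp: p q degree_mult_eq power_add)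
    show "\<alpha> (x + y) \<le> \<alpha> x + \<alpha> y"
    proof (cases "p = 0 \<or> q = 0")
      case True then show ?thesis by (auto simp: p q \<alpha>_def)
    next
      case False
      have "\<alpha> (x + y) \<le> 2 ^ degree (p + q)" using \<alpha>[OF pq(3)] by (auto simp: p q)
      also have "\<dots> \<le> 2 ^ max (degree p) (degree q)"
        by (intro power_increasing degree_add_le_max) auto
      also have "\<dots> \<le> 2 ^ degree p + (2 :: real) ^ degree q" by (auto simp: max_def)
      also have "\<dots> = \<alpha> x + \<alpha> y" using False \<alpha>[OF p(1)] \<alpha>[OF q(1)] by (simp add: p q)
      finally show ?thesis .
    qed
  qed
  moreover have "\<pi> \<in> S" unfolding S_def using int_polys_closed(2) by (intro image_eqI[of _ _ "[:0, 1:]"]) auto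
  moreover have "1 < \<alpha> \<pi>" using \<alpha>[OF int_polys_closed(2)] by simp
  ultimately show ?thesis using \<pi> by blast
qed

text \<open>Integers have value at most 1, so that the value of \<open>n\<close> lies strictly between 0 and 1 and the powers
of \<open>n\<close> are pairwise distinct. Hence the field has characteristic zero, and the usual absolute value
of the integers, in which \<open>n\<close> is large, can be used.\<close>

lemma two_absolute_values_nontrivial_on_int:
  fixes v :: "'k::field \<Rightarrow> real"
  assumes v: "na_valuation v" and n: "of_int n \<noteq> (0::'k)" "v (of_int n) \<noteq> 1"
  shows "\<exists>S \<alpha> \<pi>. subring_abs S \<alpha> \<and> \<pi> \<in> S \<and> 0 < v \<pi> \<and> v \<pi> < 1 \<and> 1 < \<alpha> \<pi>"
proof -
  let ?n = "of_int n :: 'k"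
  have vn: "0 < v ?n" "v ?n < 1"
    using na_val_of_int_le_1[OF v, of n] n na_val_nonneg[OF v, of ?n] na_val_zero_iff[OF v, of ?n] by auto
  have inj0: "m = 0" if m: "of_int m = (0::'k)" for m
  proof (rule ccontr)
    assume "m \<noteq> 0"
    have "range (of_int :: int \<Rightarrow> 'k) \<subseteq> of_int ` {0..<\<bar>m\<bar>}"
    proof
      fix y :: 'k assume "y \<in> range of_int"
      then obtain k where k: "y = of_int k" by blast
      have "k = \<bar>m\<bar> * (k div \<bar>m\<bar>) + k mod \<bar>m\<bar>" by simp
      then have "y = of_int \<bar>m\<bar> * of_int (k div \<bar>m\<bar>) + of_int (k mod \<bar>m\<bar>)"
        using k by (metis of_int_add of_int_mult)
      moreover have "of_int \<bar>m\<bar> = (0::'k)" using m by (simp add: abs_if)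
      ultimately have "y = of_int (k mod \<bar>m\<bar>)" by simp
      moreover have "k mod \<bar>m\<bar> \<in> {0..<\<bar>m\<bar>}" using \<open>m \<noteq> 0\<close> by simp
      ultimately show "y \<in> of_int ` {0..<\<bar>m\<bar>}" by blast
    qed
    then have "finite (range (of_int :: int \<Rightarrow> 'k))" by (rule finite_subset) simp
    moreover have "range (\<lambda>j. v ?n ^ j) \<subseteq> v ` range of_int"
    proof
      fix y assume "y \<in> range (\<lambda>j. v ?n ^ j)"
      then obtain j where "y = v (of_int (n ^ j))" using na_val_power[OF v, of ?n] by auto
      then show "y \<in> v ` range of_int" by blast
    qed
    ultimately have "finite (range (\<lambda>j. v ?n ^ j))" by (meson finite_imageI finite_subset)
    moreover have "inj (\<lambda>j. v ?n ^ j)"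
    proof (rule injI)
      fix i j assume "v ?n ^ i = v ?n ^ j"
      then show "i = j" using vn by (metis linorder_neqE_nat order_less_irrefl power_strict_decreasing)
    qed
    ultimately show False by (metis finite_imageD infinite_UNIV_nat)
  qed
  have inj: "i = j" if "of_int i = (of_int j :: 'k)" for i j
    using inj0[of "i - j"] that by simp
  define \<alpha> where "\<alpha> y = \<bar>real_of_int (THE i. of_int i = y)\<bar>" for y :: 'k
  have \<alpha>: "\<alpha> (of_int i) = \<bar>real_of_int i\<bar>" for i
  proof -
    have "(THE j. of_int j = (of_int i :: 'k)) = i" using inj by (intro the_equality) auto
    then show ?thesis by (simp add: \<alpha>_def)
  qed
  have "subring_abs (range of_int) \<alpha>"
    unfolding subring_abs_def
  proof (intro conjI ballI)
    show "1 \<in> range (of_int :: int \<Rightarrow> 'k)" using Ints_1 by (simp add: Ints_def)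
    fix x :: 'k assume "x \<in> range of_int"
    then obtain i where i: "x = of_int i" by blast
    show "0 \<le> \<alpha> x" by (simp add: \<alpha>_def)
    show "\<alpha> x = 0 \<longleftrightarrow> x = 0" using \<alpha>[of i] inj0[of i] by (auto simp: i)
    fix y :: 'k assume "y \<in> range of_int"
    then obtain j where j: "y = of_int j" by blast
    show "x - y \<in> range of_int" unfolding i j by (metis of_int_diff rangeI)
    show "x * y \<in> range of_int" unfolding i j by (metis of_int_mult rangeI)
    show "\<alpha> (x * y) = \<alpha> x * \<alpha> y"
      using \<alpha>[of "i * j"] \<alpha>[of i] \<alpha>[of j] by (simp add: i j abs_mult)
    show "\<alpha> (x + y) \<le> \<alpha> x + \<alpha> y"
      using \<alpha>[of "i + j"] \<alpha>[of i] \<alpha>[of j] by (simp add: i j)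
  qed
  moreover have "1 < \<alpha> ?n"
  proof -
    have "n \<noteq> 0" "n \<noteq> 1" "n \<noteq> - 1"
      using n na_val_one[OF v] na_val_minus[OF v, of 1] by auto
    then show ?thesis unfolding \<alpha> by linarith
  qed
  ultimately show ?thesis using vn by blast
qed

lemma two_absolute_values:
  fixes v :: "'k::field \<Rightarrow> real"
  assumes v: "na_valuation v" and nontriv: "\<not> trivial_valuation v"
  obtains S \<alpha> \<pi> where "subring_abs S \<alpha>" "\<pi> \<in> S" "0 < v \<pi>" "v \<pi> < 1" "1 < \<alpha> \<pi>"
proof (cases "\<forall>n. of_int n \<noteq> (0::'k) \<longrightarrow> v (of_int n) = 1")
  case True
  then show ?thesis using two_absolute_values_trivial_on_int[OF v nontriv] that by blast
next
  case False
  then show ?thesis using two_absolute_values_nontrivial_on_int[OF v] that by blast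
qed

section \<open>Ping-pong with five functions\<close>

text \<open>The hypothesis \<open>rel\<close> holds for the absolute values of five forms any four of which satisfy a linear
relation with nonzero coefficients: each of the four is bounded by a multiple of the other three. If three
functions were small against the maximum, a fourth one would attain the maximum, and the relation
omitting the fifth would bound it by the three small ones.\<close>

lemma general_position_bound:
  fixes \<phi> :: "'i::finite \<Rightarrow> 'x \<Rightarrow> real" and c :: "'i \<Rightarrow> 'i \<Rightarrow> real"
  assumes card: "CARD('i) = 5"
    and top: "\<And>x. Max (range (\<lambda>i. \<phi> i x)) > 0"
    and cpos: "\<And>m j. j \<noteq> m \<Longrightarrow> c m j > 0"
    and rel: "\<And>m l x. l \<noteq> m \<Longrightarrow> c m l * \<phi> l x \<le> (\<Sum>j\<in>UNIV - {m, l}. c m j * \<phi> j x)"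
  shows "\<exists>\<delta>. 0 < \<delta> \<and> \<delta> \<le> 1 \<and> (\<forall>x i j k. i \<noteq> j \<longrightarrow> j \<noteq> k \<longrightarrow> i \<noteq> k \<longrightarrow>
       (\<exists>l\<in>{i, j, k}. \<delta> * Max (range (\<lambda>i. \<phi> i x)) \<le> \<phi> l x))"
proof -
  define C where "C = max 1 (Max (range (\<lambda>(m, j, l). c m j / c m l)))"
  have C: "c m j / c m l \<le> C" for m j l
    unfolding C_def by (intro max.coboundedI2 Max_ge) (auto intro: image_eqI[of _ _ "(m, j, l)"])
  have C1: "C \<ge> 1" by (simp add: C_def)
  define \<delta> where "\<delta> = 1 / (3 * C)"
  have \<delta>: "0 < \<delta>" "\<delta> \<le> 1" "\<delta> * C * 3 = 1" using C1 by (auto simp: \<delta>_def)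
  have "\<exists>l\<in>{i, j, k}. \<delta> * Max (range (\<lambda>i. \<phi> i x)) \<le> \<phi> l x"
    if ijk: "i \<noteq> j" "j \<noteq> k" "i \<noteq> k" for i j k x
  proof (rule ccontr)
    let ?h = "Max (range (\<lambda>i. \<phi> i x))"
    assume "\<not> ?thesis"
    then have small: "\<phi> l x < \<delta> * ?h" if "l \<in> {i, j, k}" for l using that by force
    have "?h \<in> range (\<lambda>i. \<phi> i x)" by (intro Max_in) auto
    then obtain l where l: "?h = \<phi> l x" by blast
    have "\<delta> * ?h \<le> 1 * ?h" using \<delta> top[of x] by (intro mult_right_mono) auto
    then have lno: "l \<notin> {i, j, k}" using small[of l] l by auto
    have "card (UNIV - {i, j, k, l}) = 1"
      using card ijk lno by (subst card_Diff_subset) (auto simp: card_insert_if)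
    then obtain m where m: "UNIV - {i, j, k, l} = {m}" by (auto simp: card_1_singleton_iff)
    have ml: "l \<noteq> m" using m by blast
    have rest: "UNIV - {m, l} = {i, j, k}"
    proof -
      have "m \<notin> {i, j, k, l}" using m by blast
      then show ?thesis using m lno by blast
    qed
    have pos: "c m l > 0" using cpos[OF ml] .
    have summand: "c m p * \<phi> p x < c m l * (C * (\<delta> * ?h))" if p: "p \<in> {i, j, k}" for p
    proof -
      have "p \<noteq> m" using p rest by blast
      have "c m p * \<phi> p x < c m p * (\<delta> * ?h)"
        using small[OF p] cpos[OF \<open>p \<noteq> m\<close>] by (rule mult_strict_left_mono)
      also have "\<dots> \<le> (c m l * C) * (\<delta> * ?h)"
        using C[of m p l] pos \<delta> top[of x] by (intro mult_right_mono) (auto simp: field_simps)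
      finally show ?thesis by (simp add: mult.assoc)
    qed
    have "c m l * ?h \<le> (\<Sum>p\<in>{i, j, k}. c m p * \<phi> p x)"
      using rel[OF ml, of x] unfolding rest l .
    also have "\<dots> = c m i * \<phi> i x + c m j * \<phi> j x + c m k * \<phi> k x" using ijk by simp
    also have "\<dots> < 3 * (c m l * (C * (\<delta> * ?h)))"
      using summand[of i] summand[of j] summand[of k] by simp
    also have "\<dots> = c m l * ((\<delta> * C * 3) * ?h)" by simp
    finally show False using \<delta>(3) by simp
  qed
  then show ?thesis using \<delta>(1,2) by (intro exI[of _ \<delta>] conjI allI impI)
qed

text \<open>The letter \<open>s\<close> escapes at \<open>x\<close> if \<open>\<phi> (Some s) x\<close> is not small against the maximum \<open>h x\<close> of the five
functions; as three functions are never small together, at most two letters fail to escape. If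
\<open>s\<close> escapes at \<open>x\<close>, then \<open>h\<close> grows so much from \<open>x\<close> to \<open>act s x\<close> that the constant function
\<open>\<phi> None\<close> and the contracted function \<open>\<phi> (Some (linv s))\<close> are both small there. No third function
can be, so every letter except \<open>linv s\<close> escapes at \<open>act s x\<close>.\<close>

lemma labelling_by_ping_pong:
  fixes act :: "letter \<Rightarrow> 'x \<Rightarrow> 'x" and \<phi> :: "letter option \<Rightarrow> 'x \<Rightarrow> real"
  assumes inv: "\<And>s x. act (linv s) (act s x) = x"
    and nonneg: "\<And>i x. \<phi> i x \<ge> 0" and one: "\<And>x. \<phi> None x = 1"
    and expand: "\<And>s x. \<phi> (Some s) (act s x) = \<Lambda> * \<phi> (Some s) x"
    and contract: "\<And>s x. \<phi> (Some (linv s)) (act s x) = \<phi> (Some (linv s)) x / \<Lambda>"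
    and \<delta>: "0 < \<delta>" "\<delta> \<le> 1" and \<Lambda>: "\<Lambda> * \<delta> * \<delta> > 1"
    and general: "\<And>x i j k. i \<noteq> j \<Longrightarrow> j \<noteq> k \<Longrightarrow> i \<noteq> k \<Longrightarrow>
       \<exists>l\<in>{i, j, k}. \<delta> * Max (range (\<lambda>i. \<phi> i x)) \<le> \<phi> l x"
  shows "\<exists>l. \<forall>x s. (l x = s) \<noteq> (l (act s x) = linv s)"
proof -
  define h where "h x = Max (range (\<lambda>i. \<phi> i x))" for x
  define E where "E s = {x. \<delta> * h x \<le> \<phi> (Some s) x}" for s
  have ub: "\<phi> i x \<le> h x" for i x unfolding h_def by (intro Max_ge) auto
  have h1: "1 \<le> h x" for x using ub[of None x] one by simp
  have \<Lambda>0: "\<Lambda> > 0"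
  proof (rule ccontr)
    assume "\<not> \<Lambda> > 0"
    then have "\<Lambda> * (\<delta> * \<delta>) \<le> 0" using \<delta> by (intro mult_nonpos_nonneg) auto
    then show False using \<Lambda> by (simp add: mult.assoc)
  qed
  have \<Lambda>\<delta>: "1 < \<Lambda> * \<delta>"
  proof -
    have "\<Lambda> * \<delta> * \<delta> \<le> \<Lambda> * \<delta> * 1" using \<Lambda>0 \<delta> by (intro mult_left_mono) auto
    then show ?thesis using \<Lambda> by simp
  qed
  have grow: "\<Lambda> * \<delta> * h x \<le> h (act s x)" if "x \<in> E s" for x s
  proof -
    have "\<Lambda> * (\<delta> * h x) \<le> \<Lambda> * \<phi> (Some s) x"
      using that \<Lambda>0 by (intro mult_left_mono) (auto simp: E_def)
    also have "\<dots> \<le> h (act s x)" using ub[of "Some s" "act s x"] expand by simp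
    finally show ?thesis by (simp add: mult.assoc)
  qed
  have lower: "h x < \<delta> * h (act s x)" if "x \<in> E s" for x s
  proof -
    have "1 * h x < (\<Lambda> * \<delta> * \<delta>) * h x" using \<Lambda> h1[of x] by (intro mult_strict_right_mono) auto
    also have "\<dots> = \<delta> * (\<Lambda> * \<delta> * h x)" by simp
    also have "\<dots> \<le> \<delta> * h (act s x)" using grow[OF that] \<delta> by (intro mult_left_mono) auto
    finally show ?thesis by simp
  qed
  have mono: "h x < h (act s x)" if "x \<in> E s" for s x
  proof -
    have "\<delta> * h (act s x) \<le> 1 * h (act s x)"
      using \<delta> h1[of "act s x"] by (intro mult_right_mono) auto
    then show ?thesis using lower[OF that] by simp
  qed
  have esc: "act s x \<in> E t" if x: "x \<in> E s" and t: "t \<noteq> linv s" for s t x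
  proof -
    let ?y = "act s x"
    have "\<phi> None ?y < \<delta> * h ?y" using h1[of x] lower[OF x] one by simp
    moreover have "\<phi> (Some (linv s)) ?y < \<delta> * h ?y"
    proof -
      have "1 \<le> \<Lambda>" using \<Lambda>\<delta> mult_left_le[OF \<delta>(2) less_imp_le[OF \<Lambda>0]] by linarith
      then have "\<phi> (Some (linv s)) x / \<Lambda> \<le> \<phi> (Some (linv s)) x / 1"
        using nonneg by (intro divide_left_mono) auto
      then show ?thesis using ub[of "Some (linv s)" x] lower[OF x] contract[of s x] by simp
    qed
    moreover obtain l where "l \<in> {None, Some (linv s), Some t}" "\<delta> * h ?y \<le> \<phi> l ?y"
      using general[of None "Some (linv s)" "Some t" ?y] t unfolding h_def by auto
    ultimately show ?thesis by (auto simp: E_def)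
  qed
  show ?thesis
  proof (rule labelling_if_escaping[of act E h])
    show "x \<in> E s \<union> E t \<union> E u" if "s \<noteq> t" "t \<noteq> u" "s \<noteq> u" for s t u x
      using general[of "Some s" "Some t" "Some u" x] that by (auto simp: E_def h_def)
  qed (use inv esc mono in auto)
qed

section \<open>Affine isometries close to the identity\<close>

lemma na_normD:
  assumes v: "na_valuation v" and N: "na_norm v N"
  shows na_norm_nonneg: "\<And>x. N x \<ge> 0" and na_norm_zero_iff: "\<And>x. N x = 0 \<longleftrightarrow> x = 0"
    and na_norm_scale: "\<And>a x. N (a *s x) = v a * N x"
    and na_norm_add: "\<And>x y. N (x + y) \<le> max (N x) (N y)"
    and na_norm_minus: "\<And>x. N (- x) = N x"
    and na_norm_add_eq: "\<And>x y. N y < N x \<Longrightarrow> N (x + y) = N x"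
proof -
  show nn: "N x \<ge> 0" "N x = 0 \<longleftrightarrow> x = 0" "N (a *s x) = v a * N x" "N (x + y) \<le> max (N x) (N y)" for a x y
    using N unfolding na_norm_def by blast+
  show m: "N (- x) = N x" for x
    using nn(3)[of "- 1" x] na_val_minus[OF v, of 1] na_val_one[OF v] by simp
  show "N (x + y) = N x" if "N y < N x" for x y
    using nn(4)[of x y] nn(4)[of "x + y" "- y"] m[of y] that by auto
qed

lemma affine_isometry_compose:
  assumes "affine_isometry N f" "affine_isometry N g"
  shows "affine_isometry N (f \<circ> g)"
proof -
  obtain L t where L: "invertible L" "\<And>x. N (L *v x) = N x" "f = (\<lambda>x. L *v x + t)"
    using assms(1) unfolding affine_isometry_def by blast
  obtain M u where M: "invertible M" "\<And>x. N (M *v x) = N x" "g = (\<lambda>x. M *v x + u)"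
    using assms(2) unfolding affine_isometry_def by blast
  have "f \<circ> g = (\<lambda>x. (L ** M) *v x + (L *v u + t))"
    by (simp add: fun_eq_iff L M matrix_vector_right_distrib matrix_vector_mul_assoc add.assoc)
  moreover have "N ((L ** M) *v x) = N x" for x
    using L(2) M(2) by (simp flip: matrix_vector_mul_assoc)
  moreover have "invertible (L ** M)" using L(1) M(1) by (rule invertible_mult)
  ultimately show ?thesis unfolding affine_isometry_def by blast
qed

lemma affine_isometry_id: "affine_isometry N id"
  unfolding affine_isometry_def
  by (intro exI[of _ "mat 1"] exI[of _ 0])
     (auto simp: fun_eq_iff invertible_def intro!: exI[of _ "mat 1"])

lemma affine_isometry_inverse:
  assumes "affine_isometry N f"
  shows "\<exists>g. affine_isometry N g \<and> g \<circ> f = id \<and> f \<circ> g = id"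
proof -
  obtain L t where L: "invertible L" "\<And>x. N (L *v x) = N x" "f = (\<lambda>x. L *v x + t)"
    using assms(1) unfolding affine_isometry_def by blast
  obtain M where M: "L ** M = mat 1" "M ** L = mat 1" using L(1) unfolding invertible_def by blast
  define g where "g = (\<lambda>x. M *v x + - (M *v t))"
  have LM: "L *v (M *v x) = x" "M *v (L *v x) = x" for x
    using M by (simp_all add: matrix_vector_mul_assoc)
  have "N (M *v x) = N x" for x using L(2)[of "M *v x"] LM by simp
  moreover have "invertible M" using M unfolding invertible_def by blast
  ultimately have "affine_isometry N g" unfolding affine_isometry_def g_def by blast
  moreover have "g \<circ> f = id" "f \<circ> g = id"
    by (simp_all add: fun_eq_iff g_def L(3) LM matrix_vector_right_distrib matrix_vector_mult_diff_distrib)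
  ultimately show ?thesis by blast
qed

lemma affine_isometry_group_action:
  "group_action (affine_isometry_group N) UNIV (\<lambda>g. g)"
proof -
  let ?G = "affine_isometry_group N"
  have G: "group ?G"
  proof (rule groupI)
    fix f assume "f \<in> carrier ?G"
    then obtain g where "affine_isometry N g" "g \<circ> f = id"
      using affine_isometry_inverse[of N f] by (auto simp: affine_isometry_group_def)
    then show "\<exists>g\<in>carrier ?G. g \<otimes>\<^bsub>?G\<^esub> f = \<one>\<^bsub>?G\<^esub>"
      by (auto simp: affine_isometry_group_def)
  qed (auto simp: affine_isometry_group_def affine_isometry_compose affine_isometry_id o_assoc)
  have bij: "f \<in> Bij UNIV" if "affine_isometry N f" for f
    using affine_isometry_inverse[OF that] unfolding Bij_def by (auto intro: o_bij)
  have "(\<lambda>g. g) \<in> hom ?G (BijGroup UNIV)"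
    by (rule homI) (auto simp: affine_isometry_group_def BijGroup_def bij compose_def)
  then show ?thesis
    using G group_BijGroup by (simp add: group_action_def group_hom_def group_hom_axioms_def)
qed

text \<open>By the ultrametric inequality a linear perturbation that is strictly smaller than the identity changes
no norm; in particular its sum with the identity has trivial kernel.\<close>

lemma affine_isometry_near_identity:
  fixes D :: "'k::field ^ 'n \<Rightarrow> 'k ^ 'n"
  assumes v: "na_valuation v" and N: "na_norm v N"
    and add: "\<And>x y. D (x + y) = D x + D y" and scale: "\<And>a x. D (a *s x) = a *s D x"
    and small: "\<And>x. x \<noteq> 0 \<Longrightarrow> N (D x) < N x"
  shows "affine_isometry N (\<lambda>x. x + D x + t)"
proof -
  define L where "L = matrix (\<lambda>x. x + D x)"
  have "Vector_Spaces.linear (*s) (*s) (\<lambda>x. x + D x)"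
    by unfold_locales (auto simp: add scale vec.scale_right_distrib algebra_simps)
  then have L: "L *v x = x + D x" for x unfolding L_def by (rule matrix_works)
  have D0: "D 0 = 0" using scale[of 0 0] by simp
  have iso: "N (L *v x) = N x" for x
  proof (cases "x = 0")
    case False
    then show ?thesis unfolding L by (intro na_norm_add_eq[OF v N] small)
  qed (simp add: L D0)
  then have "L *v x = 0 \<Longrightarrow> x = 0" for x using na_norm_zero_iff[OF v N] by metis
  then have "invertible L"
    unfolding invertible_left_inverse matrix_left_invertible_ker by blast
  then show ?thesis unfolding affine_isometry_def using iso
    by (intro exI[of _ L] exI[of _ t]) (simp add: L)
qed

section \<open>Five lines in general position\<close>

definition five :: "'a \<Rightarrow> 'a \<Rightarrow> 'a \<Rightarrow> 'a \<Rightarrow> 'a \<Rightarrow> letter option \<Rightarrow> 'a" where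
  "five z x y p q i = (case i of None \<Rightarrow> z
     | Some s \<Rightarrow> if gen s then (if inverted s then q else p) else (if inverted s then y else x))"

text \<open>The affine forms \<open>1\<close>, \<open>x\<close>, \<open>y\<close>, \<open>x + y + 1\<close> and \<open>\<pi> * x + \<pi>\<^sup>2 * y + 1\<close> on the plane. The zero
sets of the last four, together with the line at infinity, are five lines no three of which are
concurrent if \<open>\<pi> \<noteq> 0\<close> and \<open>\<pi>\<^sup>2 \<noteq> 1\<close>. The form of the letter \<open>s\<close> vanishes on the line that \<open>s\<close> will contract.\<close>

definition form :: "'k::field \<Rightarrow> letter option \<Rightarrow> 'k \<Rightarrow> 'k \<Rightarrow> 'k" where
  "form \<pi> i x y = five 0 1 0 1 \<pi> i * x + five 0 0 1 1 (\<pi>\<^sup>2) i * y + five 1 0 0 1 1 i"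

text \<open>The linear relation among the four forms other than the one of index \<open>m\<close>, which is unique up to a
factor.\<close>

definition circuit :: "'k::field \<Rightarrow> letter option \<Rightarrow> letter option \<Rightarrow> 'k" where
  "circuit \<pi> = five (five 0 (\<pi> - 1) (\<pi>\<^sup>2 - 1) 1 (- 1))
     (five (1 - \<pi>) 0 (\<pi>\<^sup>2 - \<pi>) \<pi> (- 1)) (five (1 - \<pi>\<^sup>2) (\<pi> - \<pi>\<^sup>2) 0 (\<pi>\<^sup>2) (- 1))
     (five 1 \<pi> (\<pi>\<^sup>2) 0 (- 1)) (five 1 1 1 (- 1) 0)"

lemma five_simps [simp]:
  "five z x y p q None = z"
  "five z x y p q (Some (Letter False False)) = x" "five z x y p q (Some (Letter False True)) = y"
  "five z x y p q (Some (Letter True False)) = p" "five z x y p q (Some (Letter True True)) = q"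
  by (simp_all add: five_def)

lemma UNIV_letter_option: "(UNIV :: letter option set) = {None, Some (Letter False False),
    Some (Letter False True), Some (Letter True False), Some (Letter True True)}"
  by (simp add: UNIV_option_conv UNIV_letter)

lemma letter_option_cases:
  obtains "i = None" | "i = Some (Letter False False)" | "i = Some (Letter False True)"
    | "i = Some (Letter True False)" | "i = Some (Letter True True)"
  using UNIV_I[of i] unfolding UNIV_letter_option by blast

lemma letter_cases:
  obtains "s = Letter False False" | "s = Letter False True" | "s = Letter True False" | "s = Letter True True"
  using UNIV_I[of s] unfolding UNIV_letter by blast

lemma circuit_relation: "(\<Sum>i\<in>UNIV. circuit \<pi> m i * form \<pi> i x y) = 0"
  unfolding UNIV_letter_option
  by (cases m rule: letter_option_cases)
     (simp_all add: circuit_def form_def algebra_simps power2_eq_square)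

lemma circuit_self: "circuit \<pi> m m = 0"
  by (cases m rule: letter_option_cases) (simp_all add: circuit_def)

lemma circuit_nonzero:
  assumes "\<pi> \<noteq> 0" "\<pi> \<noteq> 1" "\<pi>\<^sup>2 \<noteq> 1" "i \<noteq> m"
  shows "circuit \<pi> m i \<noteq> 0"
  using assms
  by (cases m rule: letter_option_cases; cases i rule: letter_option_cases)
     (simp_all add: circuit_def power2_eq_square)

lemma circuit_in_subring:
  assumes S: "subring_abs S \<alpha>" and \<pi>: "\<pi> \<in> S"
  shows "circuit \<pi> m i \<in> S"
  by (cases m rule: letter_option_cases; cases i rule: letter_option_cases)
     (simp_all add: circuit_def \<pi> subring_abs_0[OF S] subring_abs_1[OF S] subring_abs_diff[OF S]
        subring_abs_uminus[OF S] subring_abs_power[OF S])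

lemma seminorm_form_bound:
  fixes S :: "'k::field set"
  assumes S: "subring_abs S \<alpha>" and \<pi>: "\<pi> \<in> S" "\<pi> \<noteq> 0" "\<pi> \<noteq> 1" "\<pi>\<^sup>2 \<noteq> 1"
    and \<beta>: "\<And>x y. \<beta> (x + y) \<le> \<beta> x + \<beta> y"
      "\<And>c x. c \<in> S \<Longrightarrow> \<beta> (c * x) = \<alpha> c * \<beta> x" "\<beta> 1 = 1"
  shows "\<exists>\<delta>. 0 < \<delta> \<and> \<delta> \<le> 1 \<and> (\<forall>x y i j k. i \<noteq> j \<longrightarrow> j \<noteq> k \<longrightarrow> i \<noteq> k \<longrightarrow>
       (\<exists>l\<in>{i, j, k}. \<delta> * Max (range (\<lambda>i. \<beta> (form \<pi> i x y))) \<le> \<beta> (form \<pi> l x y)))"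
proof -
  define \<phi> where "\<phi> i z = \<beta> (form \<pi> i (fst z) (snd z))" for i and z :: "'k \<times> 'k"
  define c where "c m j = \<alpha> (circuit \<pi> m j)" for m j
  note inS = circuit_in_subring[OF S \<pi>(1)]
  have \<beta>0: "\<beta> 0 = 0" using \<beta>(2)[OF subring_abs_0[OF S], of 0] subring_abs_zero_iff[OF S subring_abs_0[OF S]] by simp
  have \<beta>minus: "\<beta> (- x) = \<beta> x" for x
    using \<beta>(2)[OF subring_abs_uminus[OF S subring_abs_1[OF S]], of x] subring_abs_minus_one[OF S] by simp
  have \<beta>sum: "\<beta> (\<Sum>i\<in>A. g i) \<le> (\<Sum>i\<in>A. \<beta> (g i))" if "finite A" for g and A :: "letter option set"
    using that
  proof (induction A)
    case (insert a A)
    then show ?case using \<beta>(1)[of "g a" "sum g A"] by simp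
  qed (simp add: \<beta>0)
  have rel: "c m l * \<phi> l z \<le> (\<Sum>j\<in>UNIV - {m, l}. c m j * \<phi> j z)" if "l \<noteq> m" for m l z
  proof -
    let ?t = "\<lambda>j. circuit \<pi> m j * form \<pi> j (fst z) (snd z)"
    have "(\<Sum>j\<in>UNIV. ?t j) = (\<Sum>j\<in>UNIV - {m}. ?t j)"
      by (intro sum.mono_neutral_right) (auto simp: circuit_self)
    also have "\<dots> = ?t l + (\<Sum>j\<in>UNIV - {m} - {l}. ?t j)" using that by (intro sum.remove) auto
    also have "UNIV - {m} - {l} = UNIV - {m, l}" by blast
    finally have "?t l = - (\<Sum>j\<in>UNIV - {m, l}. ?t j)"
      unfolding circuit_relation by (simp add: eq_neg_iff_add_eq_0)
    then have "\<beta> (?t l) \<le> (\<Sum>j\<in>UNIV - {m, l}. \<beta> (?t j))"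
      using \<beta>sum[of "UNIV - {m, l}" ?t] by (simp add: \<beta>minus)
    then show ?thesis by (simp add: \<phi>_def c_def \<beta>(2)[OF inS])
  qed
  have "form \<pi> None x y = 1" for x y by (simp add: form_def)
  then have one: "\<phi> None z = 1" for z by (simp add: \<phi>_def \<beta>(3))
  have top: "Max (range (\<lambda>i. \<phi> i z)) > 0" for z
  proof -
    have "\<phi> None z \<le> Max (range (\<lambda>i. \<phi> i z))" by (intro Max_ge) auto
    then show ?thesis using one[of z] by linarith
  qed
  have card: "CARD(letter option) = 5" unfolding UNIV_letter_option by simp
  have cpos: "c m j > 0" if "j \<noteq> m" for m j
    using subring_abs_nonneg[OF S inS, of m j] subring_abs_zero_iff[OF S inS, of m j]
      circuit_nonzero[OF \<pi>(2-4) that] by (simp add: c_def)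
  have "\<exists>\<delta>. 0 < \<delta> \<and> \<delta> \<le> 1 \<and> (\<forall>z i j k. i \<noteq> j \<longrightarrow> j \<noteq> k \<longrightarrow> i \<noteq> k \<longrightarrow>
       (\<exists>l\<in>{i, j, k}. \<delta> * Max (range (\<lambda>i. \<phi> i z)) \<le> \<phi> l z))"
    by (rule general_position_bound[of \<phi> c, OF card top], erule cpos, erule rel)
  then obtain \<delta> where \<delta>01: "0 < \<delta>" "\<delta> \<le> 1" and \<delta>: "\<forall>z i j k. i \<noteq> j \<longrightarrow> j \<noteq> k \<longrightarrow> i \<noteq> k \<longrightarrow>
       (\<exists>l\<in>{i, j, k}. \<delta> * Max (range (\<lambda>i. \<phi> i z)) \<le> \<phi> l z)"
    by (elim exE conjE)
  show ?thesis
  proof (intro exI[of _ \<delta>] conjI allI impI)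
    show "\<exists>l\<in>{i, j, k}. \<delta> * Max (range (\<lambda>i. \<beta> (form \<pi> i x y))) \<le> \<beta> (form \<pi> l x y)"
      if "i \<noteq> j" "j \<noteq> k" "i \<noteq> k" for x y i j k
      using \<delta>[rule_format, OF that, of "(x, y)"] unfolding \<phi>_def fst_conv snd_conv .
  qed (fact \<delta>01)+
qed

section \<open>The action near the identity and its consequences\<close>

text \<open>Each generator is diagonal in suitable affine coordinates of the plane spanned by the coordinates \<open>i0\<close>
and \<open>j0\<close>: it multiplies one form by \<open>\<mu> = 1 + \<pi> ^ m\<close> and a second one by the inverse of \<open>\<mu>\<close>. With
\<open>m\<close> large this is close to the identity for \<open>v\<close>, hence an isometry moving the centre \<open>x0\<close> by less than
\<open>r\<close>. For \<open>\<alpha>\<close>, however, \<open>\<mu>\<close> is huge, so that the action plays ping-pong. Both the linear part and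
the translation are governed by \<open>v (\<mu> - 1) = v \<pi> ^ m\<close>, because the forms and the centre are fixed
before \<open>m\<close> is chosen.\<close>

lemma small_labelled_action:
  fixes v :: "'k::field \<Rightarrow> real" and N :: "'k ^ 'n \<Rightarrow> real"
  assumes v: "na_valuation v" and nontriv: "\<not> trivial_valuation v"
    and ij: "(i0 :: 'n) \<noteq> j0" and N: "na_norm v N"
    and C: "\<And>x i. v (x $ i) \<le> C * N x" and r: "r > 0"
  shows "\<exists>(act :: letter \<Rightarrow> 'k ^ 'n \<Rightarrow> 'k ^ 'n) (l :: 'k ^ 'n \<Rightarrow> letter).
    (\<forall>s. affine_isometry N (act s)) \<and> (\<forall>s x. act (linv s) (act s x) = x) \<and>
    (\<forall>x s. (l x = s) \<noteq> (l (act s x) = linv s)) \<and>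
    (\<forall>s x. N (x - x0) < r \<longrightarrow> N (act s x - x0) < r) \<and>
    (\<forall>s x. r \<le> N (x - x0) \<longrightarrow> N (act s x - x0) = N (x - x0))"
proof -
  obtain S \<alpha> \<pi> where S: "subring_abs S \<alpha>" and \<pi>S: "\<pi> \<in> S" and \<pi>: "0 < v \<pi>" "v \<pi> < 1" "1 < \<alpha> \<pi>"
    using two_absolute_values[OF v nontriv] .
  from seminorm_extending_subring_abs[OF S]
  obtain \<beta> :: "'k \<Rightarrow> real" where "\<forall>x. \<beta> x \<ge> 0" "\<forall>x y. \<beta> (x + y) \<le> \<beta> x + \<beta> y"
    "\<forall>c\<in>S. \<forall>x. \<beta> (c * x) = \<alpha> c * \<beta> x" "\<beta> 1 = 1"
    by (elim exE conjE)
  then have \<beta>: "\<And>x. \<beta> x \<ge> 0" "\<And>x y. \<beta> (x + y) \<le> \<beta> x + \<beta> y"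
    "\<And>c x. c \<in> S \<Longrightarrow> \<beta> (c * x) = \<alpha> c * \<beta> x" "\<beta> 1 = 1"
    by simp_all
  have v1: "v 1 = 1" by (rule na_val_one[OF v])
  have \<pi>0: "\<pi> \<noteq> 0" using \<pi>(1) na_val_zero_iff[OF v, of \<pi>] by auto
  have \<pi>1: "\<pi> \<noteq> 1" "\<pi>\<^sup>2 \<noteq> 1"
  proof -
    have "v (\<pi>\<^sup>2) < 1" unfolding na_val_power[OF v] using \<pi> by (simp add: power_less_one_iff)
    then show "\<pi> \<noteq> 1" "\<pi>\<^sup>2 \<noteq> 1" using v1 \<pi>(2) by auto
  qed
  have "\<exists>\<delta>. 0 < \<delta> \<and> \<delta> \<le> 1 \<and> (\<forall>x y i j k. i \<noteq> j \<longrightarrow> j \<noteq> k \<longrightarrow> i \<noteq> k \<longrightarrow>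
       (\<exists>l\<in>{i, j, k}. \<delta> * Max (range (\<lambda>i. \<beta> (form \<pi> i x y))) \<le> \<beta> (form \<pi> l x y)))"
    by (rule seminorm_form_bound[OF S \<pi>S \<pi>0 \<pi>1 \<beta>(2) _ \<beta>(4)]) (erule \<beta>(3))
  then obtain \<delta> where \<delta>: "0 < \<delta>" "\<delta> \<le> 1" and general: "\<forall>x y i j k. i \<noteq> j \<longrightarrow> j \<noteq> k \<longrightarrow> i \<noteq> k \<longrightarrow>
       (\<exists>l\<in>{i, j, k}. \<delta> * Max (range (\<lambda>i. \<beta> (form \<pi> i x y))) \<le> \<beta> (form \<pi> l x y))"
    by (elim exE conjE)
  define lin where "lin s x = five 0 1 0 1 \<pi> (Some s) * x $ i0 + five 0 0 1 1 (\<pi>\<^sup>2) (Some s) * x $ j0"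
    for s and x :: "'k ^ 'n"
  define k :: "letter \<Rightarrow> 'k" where "k s = five 1 0 0 1 1 (Some s)" for s
  (* The directions dual to the linear parts of the forms of s and linv s. *)
  define e where "e s = (five 0 1 0 (\<pi> / (\<pi> - 1)) (- 1 / (\<pi>\<^sup>2 - \<pi>)) (Some s)) *s axis i0 1
    + (five 0 0 1 (- 1 / (\<pi> - 1)) (1 / (\<pi>\<^sup>2 - \<pi>)) (Some s)) *s axis j0 (1::'k)" for s
  have ne: "\<pi> - 1 \<noteq> 0" "\<pi>\<^sup>2 - \<pi> \<noteq> 0" using \<pi>0 \<pi>1 by (auto simp: power2_eq_square)
  have e_comps: "e s $ i0 = five 0 1 0 (\<pi> / (\<pi> - 1)) (- 1 / (\<pi>\<^sup>2 - \<pi>)) (Some s)"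
      "e s $ j0 = five 0 0 1 (- 1 / (\<pi> - 1)) (1 / (\<pi>\<^sup>2 - \<pi>)) (Some s)" for s
    using ij by (simp_all add: e_def axis_def)
  have dual_p: "\<pi> / (\<pi> - 1) + - 1 / (\<pi> - 1) = 1" "\<pi> * (\<pi> / (\<pi> - 1)) + \<pi>\<^sup>2 * (- 1 / (\<pi> - 1)) = 0"
    using ne by (simp_all add: power2_eq_square diff_divide_distrib[symmetric])
  have dual_q: "- 1 / (\<pi>\<^sup>2 - \<pi>) + 1 / (\<pi>\<^sup>2 - \<pi>) = 0" "\<pi> * (- 1 / (\<pi>\<^sup>2 - \<pi>)) + \<pi>\<^sup>2 * (1 / (\<pi>\<^sup>2 - \<pi>)) = 1"
    using ne by (simp_all add: diff_divide_distrib[symmetric])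
  have dual: "lin s (e s) = 1" "lin s (e (linv s)) = 0" for s
    unfolding lin_def e_comps
    by (cases s rule: letter_cases;
        simp only: linv_def letter.sel five_simps not_True_eq_False not_False_eq_True
          dual_p dual_q mult_1_left mult_zero_left mult_zero_right mult_1_right add_0_left add_0_right)+
  have lin_add: "lin s (x + y) = lin s x + lin s y" for s x y by (simp add: lin_def algebra_simps)
  have lin_scale: "lin s (a *s x) = a * lin s x" for s a x by (simp add: lin_def algebra_simps)
  have form_lin: "form \<pi> (Some s) (x $ i0) (x $ j0) = lin s x + k s" for s x
    by (simp add: form_def lin_def k_def)
  have lin_le: "v (lin s x) \<le> C * N x" for s x
  proof -
    have le1: "v (five 0 1 0 1 \<pi> (Some s)) \<le> 1" "v (five 0 0 1 1 (\<pi>\<^sup>2) (Some s)) \<le> 1"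
      using \<pi> v1 na_val_zero_iff[OF v, of 0]
      by (cases s rule: letter_cases; simp add: na_val_power[OF v] power_le_one)+
    have "v (a * x $ i) \<le> C * N x" if "v a \<le> 1" for a i
    proof -
      have "v (a * x $ i) \<le> 1 * v (x $ i)"
        unfolding na_val_mult[OF v] by (rule mult_right_mono[OF that na_val_nonneg[OF v]])
      then show ?thesis using C[of x i] by simp
    qed
    from this[OF le1(1)] this[OF le1(2)] show ?thesis
      unfolding lin_def by (intro order_trans[OF na_val_add[OF v]] max.boundedI)
  qed
  have k_le: "v (k s) \<le> 1" for s
    using v1 na_val_zero_iff[OF v, of 0]
    by (cases s rule: letter_cases; simp add: k_def)
  define Q where "Q = Max (insert 1 (range (\<lambda>s. N (e s))))"
  have Q: "N (e s) \<le> Q" "1 \<le> Q" for s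
    unfolding Q_def by (intro Max_ge; simp)+
  define B where "B = max 1 C"
  have B: "C \<le> B" "1 \<le> B" by (simp_all add: B_def)
  have BQ: "0 < B" "0 < Q" "0 < B * Q" using B(2) Q(2) by (auto intro: mult_pos_pos)

  (* The first bound makes the linear part of the displacement smaller than the identity, the second
     one makes its translation part smaller than r. *)
  define \<epsilon> where "\<epsilon> = min (1 / (B * Q)) (r / Q)"
  have "\<epsilon> > 0" using BQ r by (simp add: \<epsilon>_def)
  then obtain m1 where m1: "v \<pi> ^ m1 < \<epsilon>" using real_arch_pow_inv[of \<epsilon> "v \<pi>"] \<pi>(2) by blast
  obtain m2 where m2: "1 / (\<delta> * \<delta>) + 1 < \<alpha> \<pi> ^ m2" using real_arch_pow[OF \<pi>(3)] by blast
  define m where "m = Suc (max m1 m2)"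
  have "v \<pi> ^ m \<le> v \<pi> ^ m1" using \<pi> by (intro power_decreasing) (auto simp: m_def)
  with m1 have vm: "v \<pi> ^ m < \<epsilon>" by simp
  have "\<alpha> \<pi> ^ m2 \<le> \<alpha> \<pi> ^ m" using \<pi> by (intro power_increasing) (auto simp: m_def)
  with m2 have \<alpha>m: "1 / (\<delta> * \<delta>) + 1 < \<alpha> \<pi> ^ m" by simp
  define \<mu> where "\<mu> = 1 + \<pi> ^ m"
  have \<mu>S: "\<mu> \<in> S" unfolding \<mu>_def
    by (intro subring_abs_add[OF S] subring_abs_1[OF S] subring_abs_power[OF S] \<pi>S)
  have "\<alpha> (\<mu> + (- 1)) \<le> \<alpha> \<mu> + \<alpha> (- 1)"
    by (intro subring_abs_triangle[OF S] \<mu>S subring_abs_uminus[OF S] subring_abs_1[OF S])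
  then have "\<alpha> \<pi> ^ m \<le> \<alpha> \<mu> + 1"
    by (simp add: \<mu>_def subring_abs_minus_one[OF S] subring_abs_of_power[OF S \<pi>S])
  with \<alpha>m have "1 / (\<delta> * \<delta>) < \<alpha> \<mu>" by simp
  then have \<alpha>\<mu>: "\<alpha> \<mu> * \<delta> * \<delta> > 1" using \<delta> by (simp add: field_simps)
  have vlt1: "v (\<pi> ^ m) < 1"
    unfolding na_val_power[OF v] using \<pi> by (intro power_Suc_less_one[of "v \<pi>" "max m1 m2", folded m_def]) auto
  have v\<mu>: "v \<mu> = 1" unfolding \<mu>_def using na_val_add_eq[OF v, of "\<pi> ^ m" 1] vlt1 v1 by simp
  have \<mu>0: "\<mu> \<noteq> 0" using v\<mu> na_val_zero_iff[OF v, of 0] by auto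
  have small1: "v (\<mu> - 1) = v \<pi> ^ m" by (simp add: \<mu>_def na_val_power[OF v])
  have "inverse \<mu> - 1 = - ((\<mu> - 1) / \<mu>)" using \<mu>0 by (simp add: field_simps)
  then have small2: "v (inverse \<mu> - 1) = v \<pi> ^ m"
    using small1 v\<mu> by (simp add: na_val_minus[OF v] na_val_divide[OF v])

  (* The displacement of the letter s, split into its linear part D s and its translation part t s. *)
  define D where "D s x = ((\<mu> - 1) * lin s x) *s e s + ((inverse \<mu> - 1) * lin (linv s) x) *s e (linv s)"
    for s x
  define t where "t s = ((\<mu> - 1) * k s) *s e s + ((inverse \<mu> - 1) * k (linv s)) *s e (linv s)" for s
  define act where "act s x = x + D s (x - x0) + t s" for s x
  have bound: "N ((a * b) *s e s) \<le> v \<pi> ^ m * w * Q" if "v a = v \<pi> ^ m" "v b \<le> w" for a b w s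
  proof -
    have "N ((a * b) *s e s) = v \<pi> ^ m * v b * N (e s)"
      by (simp add: na_norm_scale[OF v N] na_val_mult[OF v] that)
    also have "\<dots> \<le> v \<pi> ^ m * w * Q"
      using that(2) Q(1)[of s] \<pi>(1) na_val_nonneg[OF v, of b] na_norm_nonneg[OF v N, of "e s"]
      by (intro mult_mono mult_left_mono mult_nonneg_nonneg) auto
    finally show ?thesis .
  qed
  have t_small: "N (t s) < r" for s
  proof -
    have "N (t s) \<le> v \<pi> ^ m * 1 * Q"
      unfolding t_def
      by (intro order_trans[OF na_norm_add[OF v N]] max.boundedI bound small1 small2 k_le)
    also have "\<dots> < (r / Q) * 1 * Q" using vm BQ by (intro mult_strict_right_mono) (auto simp: \<epsilon>_def)
    finally show ?thesis using BQ by simp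
  qed
  have D_small: "N (D s x) < N x" if "x \<noteq> 0" for s x
  proof -
    have Nx: "N x > 0" using that na_norm_zero_iff[OF v N, of x] na_norm_nonneg[OF v N, of x] by simp
    have "N (D s x) \<le> v \<pi> ^ m * (C * N x) * Q"
      unfolding D_def
      by (intro order_trans[OF na_norm_add[OF v N]] max.boundedI bound small1 small2 lin_le)
    also have "\<dots> \<le> v \<pi> ^ m * (B * N x) * Q"
      using \<pi>(1) B Nx BQ by (intro mult_left_mono mult_right_mono) auto
    also have "\<dots> = v \<pi> ^ m * (B * Q) * N x" by simp
    also have "\<dots> < (1 / (B * Q)) * (B * Q) * N x"
      using vm BQ Nx by (intro mult_strict_right_mono) (simp_all add: \<epsilon>_def)
    finally show ?thesis using BQ by simp
  qed
  have D0: "D s 0 = 0" for s using lin_scale[of _ 0 0] by (simp add: D_def)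
  have D_le: "N (D s x) \<le> N x" for s x
    using D_small[of x s] D0[of s] by (cases "x = 0") auto
  have D_add: "D s (x + y) = D s x + D s y" for s x y
    by (simp add: D_def lin_add algebra_simps)
  have D_scale: "D s (a *s x) = a *s D s x" for s a x
    by (simp add: D_def lin_scale algebra_simps)
  have D_diff: "D s (x - y) = D s x - D s y" for s x y
    using D_add[of s "x - y" y] by simp
  have iso: "affine_isometry N (act s)" for s
  proof -
    have act: "act s = (\<lambda>x. x + D s x + (t s - D s x0))"
      by (simp add: fun_eq_iff act_def D_diff)
    show ?thesis
      unfolding act by (rule affine_isometry_near_identity[OF v N D_add D_scale]) (erule D_small)
  qed

  define f where "f s x = lin s (x - x0) + k s" for s x
  have act_f: "act s x = x + ((\<mu> - 1) * f s x) *s e s + ((inverse \<mu> - 1) * f (linv s) x) *s e (linv s)"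
    for s x by (simp add: act_def D_def t_def f_def algebra_simps)
  have f_shift: "f s (x + a *s y + b *s z) = f s x + a * lin s y + b * lin s z" for s x a b y z
    using lin_add[of s "x - x0 + a *s y" "b *s z"] lin_add[of s "x - x0" "a *s y"]
    by (simp add: f_def lin_scale algebra_simps)
  have f1: "f s (act s x) = \<mu> * f s x" for s x
    unfolding act_f f_shift dual by (simp add: algebra_simps)
  have f2: "f (linv s) (act s x) = inverse \<mu> * f (linv s) x" for s x
    unfolding act_f f_shift using dual[of "linv s"] by (simp add: algebra_simps)
  have inv: "act (linv s) (act s x) = x" for s x
    unfolding act_f[of "linv s" "act s x"] linv_linv f1 f2 unfolding act_f[of s x]
    using \<mu>0 by (simp add: vec_eq_iff field_simps)
  define \<phi> where "\<phi> i x = \<beta> (form \<pi> i ((x - x0) $ i0) ((x - x0) $ j0))" for i x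
  have \<phi>_f: "\<phi> (Some s) x = \<beta> (f s x)" for s x unfolding \<phi>_def form_lin f_def ..
  have "\<exists>l. \<forall>x s. (l x = s) \<noteq> (l (act s x) = linv s)"
  proof (rule labelling_by_ping_pong[of act \<phi> "\<alpha> \<mu>" \<delta>])
    show "\<phi> None x = 1" for x by (simp add: \<phi>_def form_def \<beta>(4))
    show "\<phi> (Some s) (act s x) = \<alpha> \<mu> * \<phi> (Some s) x" for s x
      by (simp add: \<phi>_f f1 \<beta>(3)[OF \<mu>S])
    have "\<alpha> \<mu> \<noteq> 0" using subring_abs_zero_iff[OF S \<mu>S] \<mu>0 by simp
    then show "\<phi> (Some (linv s)) (act s x) = \<phi> (Some (linv s)) x / \<alpha> \<mu>" for s x
      using \<beta>(3)[OF \<mu>S, of "inverse \<mu> * f (linv s) x"] \<mu>0 by (simp add: \<phi>_f f2 field_simps)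
    show "\<exists>l\<in>{i, j, k}. \<delta> * Max (range (\<lambda>i. \<phi> i x)) \<le> \<phi> l x" if "i \<noteq> j" "j \<noteq> k" "i \<noteq> k" for x i j k
      unfolding \<phi>_def using general[rule_format, OF that] .
  qed (use inv \<beta>(1) \<delta> \<alpha>\<mu> in \<open>auto simp: \<phi>_def\<close>)
  then obtain l where l: "\<forall>x s. (l x = s) \<noteq> (l (act s x) = linv s)" ..

  have shift: "act s x - x0 = (x - x0 + D s (x - x0)) + t s" for s x by (simp add: act_def)
  have Nshift: "N (x - x0 + D s (x - x0)) = N (x - x0)" for s x
    using na_norm_add_eq[OF v N D_small] D0[of s] by (cases "x = x0") auto
  show ?thesis
  proof (intro exI[of _ act] exI[of _ l] conjI allI impI)
    show "N (act s x - x0) < r" if "N (x - x0) < r" for s x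
      using na_norm_add[OF v N, of "x - x0 + D s (x - x0)" "t s"] Nshift[of x s] t_small[of s] that
      unfolding shift by simp
    show "N (act s x - x0) = N (x - x0)" if "r \<le> N (x - x0)" for s x
      using na_norm_add_eq[OF v N, of "t s" "x - x0 + D s (x - x0)"] Nshift[of x s] t_small[of s] that
      unfolding shift by simp
  qed (rule iso, rule inv, rule l[rule_format])
qed

text \<open>The whole space and the balls and spheres of radius \<open>r\<close> around \<open>x0\<close> are unions of spheres of radius
at least \<open>r\<close> around \<open>x0\<close> and possibly of the open ball of radius \<open>r\<close>, which is the meaning of
\<open>pres\<close>. An isometry that moves \<open>x0\<close> by less than \<open>r\<close> preserves every such set.\<close>

lemma paradoxical_if_preserved:
  fixes v :: "'k::field \<Rightarrow> real" and N :: "'k ^ 'n \<Rightarrow> real"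
  assumes v: "na_valuation v" and nontriv: "\<not> trivial_valuation v"
    and card: "CARD('n) \<ge> 2" and N: "na_norm v N" and equiv: "equivalent_norms N (max_norm v)"
    and r: "r > 0" and E: "E \<noteq> {}"
    and pres: "\<And>x y. x \<in> E \<Longrightarrow> (N (x - x0) < r \<and> N (y - x0) < r) \<or> N (y - x0) = N (x - x0) \<Longrightarrow> y \<in> E"
  shows "paradoxical_using (affine_isometry_group N) UNIV (\<lambda>g. g) E 4"
proof -
  obtain i0 j0 :: 'n where ij: "i0 \<noteq> j0"
    using card by (metis UNIV_I card_2_iff' ex_card)
  obtain C where C: "\<And>x. max_norm v x \<le> C * N x"
    using equiv unfolding equivalent_norms_def by blast
  have C': "v (x $ i) \<le> C * N x" for x i
    using C[of x] Max_ge[of "range (\<lambda>i. v (x $ i))" "v (x $ i)"] by (auto simp: max_norm_def)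
  from small_labelled_action[OF v nontriv ij N C' r, of x0]
  obtain act :: "letter \<Rightarrow> 'k ^ 'n \<Rightarrow> 'k ^ 'n" and l where act: "\<forall>s. affine_isometry N (act s)"
      "\<forall>s x. act (linv s) (act s x) = x" "\<forall>x s. (l x = s) \<noteq> (l (act s x) = linv s)"
      "\<forall>s x. N (x - x0) < r \<longrightarrow> N (act s x - x0) < r"
      "\<forall>s x. r \<le> N (x - x0) \<longrightarrow> N (act s x - x0) = N (x - x0)"
    by (elim exE conjE)
  show ?thesis
  proof (rule paradoxical_four_if_labelling[of _ _ E act l])
    show "act s x \<in> E" if "x \<in> E" for s x
      using act(4)[rule_format, of x s] act(5)[rule_format, of x s]
      by (intro pres[OF that]) linarith
    show "\<exists>g\<in>carrier (affine_isometry_group N). g = act s" for s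
      using act(1) by (simp add: affine_isometry_group_def)
    show "act (linv s) (act s x) = x" "(l x = s) \<noteq> (l (act s x) = linv s)" for s x
      by (rule act(2)[rule_format], rule act(3)[rule_format])
  qed (use E affine_isometry_group_action in simp_all)
qed

theorem theorem3p10:
  fixes v :: "'k::field \<Rightarrow> real"
    and N :: "'k ^ 'n \<Rightarrow> real"
  assumes "na_valuation v" and "\<not> trivial_valuation v"
    and "CARD('n) \<ge> 2"
    and "na_norm v N" and "equivalent_norms N (max_norm v)"
  shows "paradoxical_using (affine_isometry_group N) UNIV (\<lambda>g. g) UNIV 4 \<and>
    (\<forall>x0 r. r > 0 \<longrightarrow>
       paradoxical_using (affine_isometry_group N) UNIV (\<lambda>g. g) (norm_cball N x0 r) 4 \<and>
       paradoxical_using (affine_isometry_group N) UNIV (\<lambda>g. g) (norm_ball N x0 r) 4 \<and>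
       (norm_sphere N x0 r \<noteq> {} \<longrightarrow>
          paradoxical_using (affine_isometry_group N) UNIV (\<lambda>g. g) (norm_sphere N x0 r) 4))"
proof -
  note main = paradoxical_if_preserved[OF assms]
  have N0: "N 0 = 0" using assms(4) by (simp add: na_norm_def)
  show ?thesis
  proof (intro conjI allI impI)
    show "paradoxical_using (affine_isometry_group N) UNIV (\<lambda>g. g) UNIV 4"
      by (rule main[of 1 _ 0]) auto
    fix x0 :: "'k ^ 'n" and r :: real assume r: "r > 0"
    have "x0 \<in> norm_cball N x0 r" "x0 \<in> norm_ball N x0 r"
      using r N0 by (simp_all add: norm_cball_def norm_ball_def)
    then have x0: "norm_cball N x0 r \<noteq> {}" "norm_ball N x0 r \<noteq> {}" by blast+
    show "paradoxical_using (affine_isometry_group N) UNIV (\<lambda>g. g) (norm_cball N x0 r) 4"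
      by (rule main[of r "norm_cball N x0 r" x0, OF r]) (use x0 in \<open>auto simp: norm_cball_def\<close>)
    show "paradoxical_using (affine_isometry_group N) UNIV (\<lambda>g. g) (norm_ball N x0 r) 4"
      by (rule main[of r "norm_ball N x0 r" x0, OF r]) (use x0 in \<open>auto simp: norm_ball_def\<close>)
    assume "norm_sphere N x0 r \<noteq> {}"
    then show "paradoxical_using (affine_isometry_group N) UNIV (\<lambda>g. g) (norm_sphere N x0 r) 4"
      by (rule main[of r _ x0, OF r]) (auto simp: norm_sphere_def)
  qed
qed

end
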